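(* Let $p$ be an odd prime and let $S$ be a commutative $p$-scheme of order $p^4$. Assume that one of the following conditions holds. (1) $\mathbf{O}^{\theta}(S) = \mathbf{O}_{\theta}(S)$, $n_{\mathbf{O}_{\theta}(S)} = p^2$ and $S/\!/\mathbf{O}^{\theta}(S) \cong C_{p^2}$, the cyclic group of order $p^2$. (2) $n_{\mathbf{O}_{\theta}(S)} = n_{\mathbf{O}^{\theta}(S)} = p^2$, $\mathbf{O}^{\theta}(S) \neq \mathbf{O}_{\theta}(S)$, and $n_s = p^2$ for each $s \in S \setminus \mathbf{O}_{\theta}(S)\mathbf{O}^{\theta}(S)$. (3) $n_{\mathbf{O}_{\theta}(S)} = p^3$. Then $S$ is schurian.
   Context: Let $X$ be a nonempty finite set and $S$ a partition of $X\times X$. $S$ is an association scheme (scheme) on $X$ if: (i) $1_X := \{(x,x) \mid x\in X\} \in S$; (ii) for each $s\in S$, $s^* := \{(x,y) \mid (y,x)\in s\} \in S$; (iii) for all $s,t,u\in S$ and $x,y \in X$, the number $a_{stu} := |xs\cap yt^*|$ is constant whenever $(x,y)\in u$, where $xs := \{y\in X \mid (x,y)\in s\}$. $S$ is commutative if $a_{stu}=a_{tsu}$ for all $s,t,u\in S$. The valency of $s\in S$ is $n_s := a_{ss^*1_X}$ (so $n_s=|xs|$ for every $x \in X$); for $U\subseteq S$ the order of $U$ is $n_U := \sum_{u\in U} n_u$. Thus the order of $S$ is $n_S=|X|$. For a prime $p$, $S$ is a $p$-scheme if $|X|$ and all valencies $n_s$ ($s\in S$) are powers of $p$ (with $1=p^0$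 allowed). For nonempty $P,Q\subseteq S$, the complex product $PQ$ is the set of all $s\in S$ such that $a_{pqs}\neq 0$ for some $p\in P$, $q\in Q$; a singleton $\{s\}$ is written $s$. A nonempty $T\subseteq S$ is closed if $TT\subseteq T$. A closed subset is thin if all its elements have valency 1; a thin closed subset is a group under relational product, and likewise a scheme all of whose elements have valency 1 is identified with a group. The thin radical of $S$ is $\mathbf{O}_{\theta}(S) := \{s\in S \mid n_s=1\}$. A closed subset $T$ is strongly normal in $S$ if $s^*Ts\subseteq T$ for every $s\in S$. The thin residue $\mathbf{O}^{\theta}(S)$ is the intersection of all strongly normal closed subsets of $S$; equivalently, it is the closed subset generated by $\bigcup_{s\in S}s^*s$. For a closed subset $T$ of $S$, put $xT:=\bigcup_{t\in T}xt$, $X/T := \{xT \mid x\in X\}$, and $S/\!/T := \{s^T \mid s\in S\}$ where $s^T := \{(xT,yT) \mid y\in xTsT\}$ (here $xTsT:=\bigcup_{u\in TsT}xu$). $S/\!/T$ is a scheme on $X/T$ (the quotient scheme), and it is a group (thin) exactly when $T$ is strongly normal. $S$ is schurian if there is a transitive permutation group $G$ on $X$ such that $S$ is the set of orbits of $G$ acting componentwise on $X\times X$. *)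

theory Defs
  imports
    "HOL-Library.Disjoint_Sets"
    "HOL-Computational_Algebra.Primes"
    "HOL-Algebra.Group_Action"
    "HOL-Algebra.Elementary_Groups"
begin

text \<open>
  A scheme is given by a point set \<open>X\<close> and a set \<open>S\<close> of relations on \<open>X\<close>.
  The set \<open>xs\<close> is \<open>s `` {x}\<close>, the relation \<open>s\<^sup>*\<close> is \<open>s\<inverse>\<close>,
  and the diagonal of \<open>X\<close> is \<open>Id_on X\<close>.
\<close>

definition association_scheme :: "'a set \<Rightarrow> 'a rel set \<Rightarrow> bool" where
  "association_scheme X S \<longleftrightarrow>
     finite X \<and> X \<noteq> {} \<and> partition_on (X \<times> X) S \<and>
     Id_on X \<in> S \<and>
     (\<forall>s\<in>S. s\<inverse> \<in> S) \<and>
     (\<forall>s\<in>S. \<forall>t\<in>S. \<forall>u\<in>S. \<exists>n. \<forall>(x, y)\<in>u. card (s `` {x} \<inter> t\<inverse> `` {y}) = n)"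

text \<open>
  The description below determines a unique number because the members of a scheme are nonempty;
  it is only used for \<open>s\<close>, \<open>t\<close>, \<open>u\<close> in a scheme.
\<close>

definition structure_constant :: "'a rel \<Rightarrow> 'a rel \<Rightarrow> 'a rel \<Rightarrow> nat" where
  "structure_constant s t u =
     (THE n. \<forall>(x, y)\<in>u. card (s `` {x} \<inter> t\<inverse> `` {y}) = n)"

definition commutative_scheme :: "'a rel set \<Rightarrow> bool" where
  "commutative_scheme S \<longleftrightarrow>
     (\<forall>s\<in>S. \<forall>t\<in>S. \<forall>u\<in>S. structure_constant s t u = structure_constant t s u)"

definition valency :: "'a set \<Rightarrow> 'a rel \<Rightarrow> nat" where
  "valency X s = structure_constant s (s\<inverse>) (Id_on X)"

definition scheme_order :: "'a set \<Rightarrow> 'a rel set \<Rightarrow> nat" where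
  "scheme_order X U = (\<Sum>u\<in>U. valency X u)"

definition p_scheme :: "nat \<Rightarrow> 'a set \<Rightarrow> 'a rel set \<Rightarrow> bool" where
  "p_scheme p X S \<longleftrightarrow>
     association_scheme X S \<and> (\<exists>k. card X = p ^ k) \<and> (\<forall>s\<in>S. \<exists>k. valency X s = p ^ k)"

definition complex_product :: "'a rel set \<Rightarrow> 'a rel set \<Rightarrow> 'a rel set \<Rightarrow> 'a rel set" where
  "complex_product S P Q = {s \<in> S. \<exists>p\<in>P. \<exists>q\<in>Q. structure_constant p q s \<noteq> 0}"

definition closed_subset :: "'a rel set \<Rightarrow> 'a rel set \<Rightarrow> bool" where
  "closed_subset S T \<longleftrightarrow> T \<noteq> {} \<and> T \<subseteq> S \<and> complex_product S T T \<subseteq> T"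

definition thin_radical :: "'a set \<Rightarrow> 'a rel set \<Rightarrow> 'a rel set" where
  "thin_radical X S = {s \<in> S. valency X s = 1}"

definition strongly_normal :: "'a rel set \<Rightarrow> 'a rel set \<Rightarrow> bool" where
  "strongly_normal S T \<longleftrightarrow>
     closed_subset S T \<and>
     (\<forall>s\<in>S. complex_product S (complex_product S {s\<inverse>} T) {s} \<subseteq> T)"

definition thin_residue :: "'a rel set \<Rightarrow> 'a rel set" where
  "thin_residue S = \<Inter> {T. strongly_normal S T}"

definition scheme_coset :: "'a \<Rightarrow> 'a rel set \<Rightarrow> 'a set" where
  "scheme_coset x U = (\<Union>u\<in>U. u `` {x})"

definition quotient_points :: "'a set \<Rightarrow> 'a rel set \<Rightarrow> 'a set set" where
  "quotient_points X T = {scheme_coset x T | x. x \<in> X}"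

definition quotient_relation ::
    "'a set \<Rightarrow> 'a rel set \<Rightarrow> 'a rel set \<Rightarrow> 'a rel \<Rightarrow> 'a set rel" where
  "quotient_relation X S T s =
     {(scheme_coset x T, scheme_coset y T) | x y.
        x \<in> X \<and> y \<in> scheme_coset x (complex_product S (complex_product S T {s}) T)}"

definition quotient_scheme :: "'a set \<Rightarrow> 'a rel set \<Rightarrow> 'a rel set \<Rightarrow> 'a set rel set" where
  "quotient_scheme X S T = {quotient_relation X S T s | s. s \<in> S}"

text \<open>
  For a thin scheme this is the group with which the scheme is identified. Note that
  \<open>r O s\<close> applies \<open>r\<close> first, in agreement with the order of factors in complex products.
\<close>

definition scheme_monoid :: "'a set \<Rightarrow> 'a rel set \<Rightarrow> 'a rel monoid" where
  "scheme_monoid X S = \<lparr>carrier = S, mult = (O), one = Id_on X\<rparr>"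

definition schurian :: "'a set \<Rightarrow> 'a rel set \<Rightarrow> bool" where
  "schurian X S \<longleftrightarrow>
     (\<exists>G. subgroup G (BijGroup X) \<and>
          (\<forall>x\<in>X. \<forall>y\<in>X. \<exists>g\<in>G. g x = y) \<and>
          S = orbits ((BijGroup X)\<lparr>carrier := G\<rparr>) (X \<times> X) (\<lambda>g. map_prod g g))"

end

theory Submission
  imports Defs
begin

text \<open>
  Call a closed subset \<open>U\<close> homogeneous if any two pairs of points in the same \<open>s \<in> U\<close> are related
  by a map between their \<open>U\<close>-cosets that respects the elements of \<open>U\<close>; then \<open>S\<close> is schurian if \<open>S\<close>
  itself is homogeneous. Homogeneity passes from \<open>A\<close> to a larger closed subset \<open>M\<close> as soon as some
  closed \<open>B\<close> satisfies \<open>m\<^sup>*m \<subseteq> B\<close> for all \<open>m \<in> M\<close> and \<open>mB = {m}\<close> for all \<open>m \<in> M - A\<close>: the maps on the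
  \<open>A\<close>-cosets can be chosen independently, subject only to the images of one point per coset.

  Let \<open>T\<close> be the thin radical and \<open>R\<close> the thin residue. The extension step leads from the diagonal to
  \<open>T\<close>. It then leads from \<open>T\<close> to \<open>S\<close> in case (3), with \<open>B = s\<^sup>*s\<close> for any \<open>s \<notin> T\<close>; to the preimage \<open>U\<close> of
  the subgroup of order \<open>p\<close> of \<open>S//T\<close>, with \<open>B = s\<^sup>*s\<close> for any \<open>s \<in> U - T\<close>, and from there with \<open>B = T\<close>
  to \<open>S\<close> in case (1); and to \<open>TR\<close> with
  \<open>B = T \<inter> R\<close> and from there with \<open>B = R\<close> to \<open>S\<close> in case (2).
\<close>

section \<open>Regularity, products and valencies in a commutative scheme\<close>

locale comm_scheme =
  fixes X :: "'a set" and S :: "'a rel set"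
  assumes scheme: "association_scheme X S" and commutative: "commutative_scheme S"
begin

lemma finite_X: "finite X" and X_nonempty: "X \<noteq> {}" and partition_S: "partition_on (X \<times> X) S"
  and Id_in: "Id_on X \<in> S" and converse_in: "s \<in> S \<Longrightarrow> s\<inverse> \<in> S"
  using scheme unfolding association_scheme_def by auto

lemma rel_subset: "s \<in> S \<Longrightarrow> s \<subseteq> X \<times> X"
  using partition_S unfolding partition_on_def by blast

lemma in_X: assumes "s \<in> S" "(x, y) \<in> s" shows "x \<in> X" "y \<in> X"
  using rel_subset assms by auto

lemma rel_nonempty: assumes "s \<in> S" obtains x y where "(x, y) \<in> s"
  using partition_S assms unfolding partition_on_def
  by (metis ex_in_conv surj_pair)

lemma rel_ex: assumes "x \<in> X" "y \<in> X" obtains s where "s \<in> S" "(x, y) \<in> s"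
  using partition_S assms unfolding partition_on_def by blast

lemma rel_unique: "s \<in> S \<Longrightarrow> t \<in> S \<Longrightarrow> (x, y) \<in> s \<Longrightarrow> (x, y) \<in> t \<Longrightarrow> s = t"
  using partition_S unfolding partition_on_def disjoint_def by blast

lemma finite_S: "finite S"
  by (rule finite_subset[of _ "Pow (X \<times> X)"]) (use rel_subset finite_X in auto)

lemma finite_Image: "s \<in> S \<Longrightarrow> finite (s `` A)"
  by (rule finite_subset[OF _ finite_X]) (use in_X in auto)

lemma in_Union_iff: "U \<subseteq> S \<Longrightarrow> s \<in> S \<Longrightarrow> (x, y) \<in> s \<Longrightarrow> (x, y) \<in> \<Union>U \<longleftrightarrow> s \<in> U"
  using rel_unique by blast

lemma structure_constant_eq:
  assumes "s \<in> S" "t \<in> S" "u \<in> S" "(x, y) \<in> u"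
  shows "card (s `` {x} \<inter> t\<inverse> `` {y}) = structure_constant s t u"
proof -
  obtain n where n: "\<forall>(x, y)\<in>u. card (s `` {x} \<inter> t\<inverse> `` {y}) = n"
    using scheme assms unfolding association_scheme_def by blast
  have "structure_constant s t u = n"
    unfolding structure_constant_def using n assms(4) by (intro the_equality) auto
  then show ?thesis using n assms(4) by auto
qed

lemma structure_constant_nonzero:
  assumes "s \<in> S" "t \<in> S" "u \<in> S" "(x, y) \<in> u"
  shows "structure_constant s t u \<noteq> 0 \<longleftrightarrow> (x, y) \<in> s O t"
proof -
  have "finite (s `` {x} \<inter> t\<inverse> `` {y})" using finite_Image assms(1) by blast
  then have "structure_constant s t u \<noteq> 0 \<longleftrightarrow> s `` {x} \<inter> t\<inverse> `` {y} \<noteq> {}"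
    using structure_constant_eq[OF assms] by (metis card_eq_0_iff)
  then show ?thesis by blast
qed

text \<open>Regularity in the form used by later arguments on paths: nonvanishing of a structure
  constant does not depend on the pair chosen in \<open>u\<close>.\<close>

lemma relcomp_transfer:
  assumes "s \<in> S" "t \<in> S" "u \<in> S" "(x, y) \<in> u" "(x', y') \<in> u" "(x, y) \<in> s O t"
  shows "(x', y') \<in> s O t"
  using structure_constant_nonzero assms by metis

text \<open>Equal structure constants vanish together, so commutativity of the scheme becomes
  commutativity of relational composition.\<close>

lemma relcomp_commute: assumes "s \<in> S" "t \<in> S" shows "s O t = t O s"
proof -
  have "(x, y) \<in> t O s" if st: "s \<in> S" "t \<in> S" "(x, y) \<in> s O t" for s t x y
  proof -
    have "x \<in> X" "y \<in> X" using that in_X by blast+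
    then obtain u where u: "u \<in> S" "(x, y) \<in> u" by (rule rel_ex)
    have "structure_constant s t u = structure_constant t s u"
      using commutative st u unfolding commutative_scheme_def by blast
    then show ?thesis using structure_constant_nonzero st u by metis
  qed
  then show ?thesis using assms by (intro equalityI subrelI) blast+
qed

lemma Union_relcomp_commute: assumes "P \<subseteq> S" "Q \<subseteq> S" shows "\<Union>P O \<Union>Q = \<Union>Q O \<Union>P"
proof -
  have "\<Union>P O \<Union>Q = (\<Union>s\<in>P. \<Union>t\<in>Q. s O t)" by blast
  also have "\<dots> = (\<Union>s\<in>P. \<Union>t\<in>Q. t O s)" using assms relcomp_commute by (intro SUP_cong) blast+
  also have "\<dots> = \<Union>Q O \<Union>P" by blast
  finally show ?thesis .
qed

lemma relcomp_Union_commute: "P \<subseteq> S \<Longrightarrow> s \<in> S \<Longrightarrow> \<Union>P O s = s O \<Union>P"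
  using Union_relcomp_commute[of P "{s}"] by simp

lemma complex_product_iff:
  assumes "P \<subseteq> S" "Q \<subseteq> S" "s \<in> S" "(x, y) \<in> s"
  shows "s \<in> complex_product S P Q \<longleftrightarrow> (x, y) \<in> \<Union>P O \<Union>Q"
proof -
  have "s \<in> complex_product S P Q \<longleftrightarrow> (\<exists>p\<in>P. \<exists>q\<in>Q. (x, y) \<in> p O q)"
    unfolding complex_product_def using structure_constant_nonzero[OF _ _ assms(3,4)] assms(1-3)
    by (simp add: subset_iff cong: bex_cong)
  then show ?thesis by blast
qed

lemma complex_product_subset: "complex_product S P Q \<subseteq> S"
  unfolding complex_product_def by blast

text \<open>Translates subsets of \<open>S\<close> into relations on \<open>X\<close>, where complex
  products are handled by composing paths; \<open>Union_subset_iff\<close> translates inclusions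
  back.\<close>

lemma Union_complex_product:
  assumes "P \<subseteq> S" "Q \<subseteq> S" shows "\<Union>(complex_product S P Q) = \<Union>P O \<Union>Q"
proof (intro equalityI subsetI; clarify)
  fix x y s assume s: "s \<in> complex_product S P Q" "(x, y) \<in> s"
  then have "s \<in> S" using complex_product_subset by blast
  then show "(x, y) \<in> \<Union>P O \<Union>Q" using complex_product_iff[OF assms _ s(2)] s(1) by metis
next
  fix x y z p q assume *: "(x, y) \<in> p" "p \<in> P" "(y, z) \<in> q" "q \<in> Q"
  then have "x \<in> X" "z \<in> X" using assms in_X by blast+
  then obtain s where s: "s \<in> S" "(x, z) \<in> s" by (rule rel_ex)
  have "(x, z) \<in> \<Union>P O \<Union>Q" using * by blast
  then show "(x, z) \<in> \<Union>(complex_product S P Q)"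
    using complex_product_iff[OF assms s] s(2) by blast
qed

lemma Union_subset_iff: assumes "P \<subseteq> S" "Q \<subseteq> S" shows "\<Union>P \<subseteq> \<Union>Q \<longleftrightarrow> P \<subseteq> Q"
proof
  assume sub: "\<Union>P \<subseteq> \<Union>Q"
  show "P \<subseteq> Q"
  proof
    fix s assume s: "s \<in> P"
    then have "s \<in> S" using assms by blast
    then obtain x y where "(x, y) \<in> s" by (rule rel_nonempty)
    then show "s \<in> Q" using in_Union_iff[OF assms(2) \<open>s \<in> S\<close>, of x y] s sub by blast
  qed
qed blast

lemma complex_product_subset_iff:
  assumes "P \<subseteq> S" "Q \<subseteq> S" "U \<subseteq> S"
  shows "complex_product S P Q \<subseteq> U \<longleftrightarrow> \<Union>P O \<Union>Q \<subseteq> \<Union>U"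
  using Union_subset_iff[OF complex_product_subset assms(3), of P Q]
    Union_complex_product[OF assms(1,2)] by simp

lemma valency_eq: assumes "s \<in> S" "x \<in> X" shows "card (s `` {x}) = valency X s"
proof -
  have "card (s `` {x} \<inter> (s\<inverse>)\<inverse> `` {x}) = valency X s" unfolding valency_def
    using structure_constant_eq[OF assms(1) converse_in[OF assms(1)] Id_in, of x x] assms(2) by auto
  then show ?thesis by simp
qed

lemma valency_pos: assumes "s \<in> S" shows "valency X s > 0"
proof -
  obtain x y where "(x, y) \<in> s" using assms by (rule rel_nonempty)
  then have "s `` {x} \<noteq> {}" "x \<in> X" using in_X assms by blast+
  then show ?thesis using valency_eq[OF assms, of x] finite_Image[OF assms, of "{x}"]
    by (metis card_gt_0_iff)
qed

lemma successor: assumes "s \<in> S" "x \<in> X" obtains y where "(x, y) \<in> s"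
proof -
  have "s `` {x} \<noteq> {}"
    using valency_pos[OF assms(1)] valency_eq[OF assms] by (metis card.empty less_irrefl)
  then show ?thesis using that by blast
qed

text \<open>Distinct relations lead from \<open>x\<close> to disjoint sets of points, so the sum of
  valencies counts a coset.\<close>

lemma scheme_order_eq: assumes "U \<subseteq> S" "x \<in> X" shows "card (\<Union>U `` {x}) = scheme_order X U"
proof -
  have "\<Union>U `` {x} = (\<Union>s\<in>U. s `` {x})" by blast
  also have "card \<dots> = (\<Sum>s\<in>U. card (s `` {x}))"
  proof (rule card_UN_disjoint)
    show "finite U" using assms finite_S finite_subset by blast
    show "\<forall>s\<in>U. finite (s `` {x})" using assms finite_Image by blast
    show "\<forall>i\<in>U. \<forall>j\<in>U. i \<noteq> j \<longrightarrow> i `` {x} \<inter> j `` {x} = {}" using assms rel_unique by blast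
  qed
  also have "\<dots> = scheme_order X U"
    unfolding scheme_order_def using valency_eq assms by (intro sum.cong) auto
  finally show ?thesis .
qed

lemma Union_S: "\<Union>S = X \<times> X"
  using partition_S unfolding partition_on_def by blast

lemma scheme_order_S: "scheme_order X S = card X"
proof -
  obtain x where "x \<in> X" using X_nonempty by blast
  then have "\<Union>S `` {x} = X" unfolding Union_S by auto
  then show ?thesis using scheme_order_eq[OF subset_refl \<open>x \<in> X\<close>] by simp
qed

lemma Union_in_X: assumes "U \<subseteq> S" shows "\<Union>U \<subseteq> X \<times> X"
  using rel_subset assms by blast

section \<open>Closed subsets as equivalence relations\<close>

lemma closed_subset_subset: "closed_subset S U \<Longrightarrow> U \<subseteq> S"
  unfolding closed_subset_def by blast

lemma closed_subsetI:
  assumes "U \<subseteq> S" "Id_on X \<in> U" "\<Union>U O \<Union>U \<subseteq> \<Union>U"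
  shows "closed_subset S U"
  using assms complex_product_subset_iff[of U U U] unfolding closed_subset_def by blast

text \<open>Finiteness makes a closed subset symmetric: if \<open>y \<in> xU\<close>, then \<open>yU \<subseteq> xU\<close> and both
  sets have the same number of elements.\<close>

lemma closed_equiv: assumes "closed_subset S U" shows "equiv X (\<Union>U)"
proof -
  have U: "U \<noteq> {}" "U \<subseteq> S" "\<Union>U O \<Union>U \<subseteq> \<Union>U"
    using assms complex_product_subset_iff[of U U U] unfolding closed_subset_def by auto
  have *: "\<Union>U `` {y} = \<Union>U `` {x}" if "(x, y) \<in> \<Union>U" for x y
  proof (rule card_subset_eq)
    have "x \<in> X" "y \<in> X" using that U(2) in_X by blast+
    then show "card (\<Union>U `` {y}) = card (\<Union>U `` {x})"
      using scheme_order_eq[OF U(2)] by simp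
    show "finite (\<Union>U `` {x})"
      by (rule finite_subset[OF _ finite_X]) (use U(2) in_X in blast)
    show "\<Union>U `` {y} \<subseteq> \<Union>U `` {x}" using that U(3) by blast
  qed
  have Id: "Id_on X \<in> U"
  proof -
    obtain s where s: "s \<in> U" using U by blast
    then have "s \<in> S" using U by blast
    then obtain x y where xy: "(x, y) \<in> s" by (rule rel_nonempty)
    note sxy = s xy
    \<comment> \<open>The point \<open>y\<close> lies in the coset of \<open>x\<close>, which is
      also the coset of \<open>y\<close>.\<close>
    then have "(y, y) \<in> \<Union>U" using *[of x y] by blast
    moreover have "(y, y) \<in> Id_on X" using sxy in_X U by blast
    ultimately show ?thesis using in_Union_iff[OF U(2) Id_in] by blast
  qed
  have refl: "(x, x) \<in> \<Union>U" if "x \<in> X" for x using Id that by blast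
  show ?thesis
  proof (rule equivI)
    show "\<Union>U \<subseteq> X \<times> X" using U rel_subset by blast
    show "refl_on X (\<Union>U)" using refl by (auto intro!: refl_onI)
    show "sym (\<Union>U)"
    proof (rule symI)
      fix x y assume xy: "(x, y) \<in> \<Union>U"
      then have "x \<in> X" using Union_in_X[OF U(2)] by blast
      then show "(y, x) \<in> \<Union>U" using *[OF xy] refl[of x] by blast
    qed
    show "trans (\<Union>U)" using U(3) by (intro transI) (meson relcompI subsetD)
  qed
qed

lemma closed_Id: assumes "closed_subset S U" shows "Id_on X \<in> U"
proof -
  obtain x where x: "x \<in> X" using X_nonempty by blast
  then have "(x, x) \<in> \<Union>U" using equiv_class_self[OF closed_equiv[OF assms]] by blast
  then show ?thesis using x in_Union_iff[OF closed_subset_subset[OF assms] Id_in] by blast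
qed

lemma closed_refl: "closed_subset S U \<Longrightarrow> x \<in> X \<Longrightarrow> (x, x) \<in> \<Union>U"
  using closed_Id by blast

lemma closed_sym: "closed_subset S U \<Longrightarrow> (x, y) \<in> \<Union>U \<Longrightarrow> (y, x) \<in> \<Union>U"
  using closed_equiv equiv_def symE by metis

lemma closed_trans:
  "closed_subset S U \<Longrightarrow> (x, y) \<in> \<Union>U \<Longrightarrow> (y, z) \<in> \<Union>U \<Longrightarrow> (x, z) \<in> \<Union>U"
  using closed_equiv equiv_def transE by metis

lemma closed_class_eq:
  "closed_subset S U \<Longrightarrow> (x, y) \<in> \<Union>U \<Longrightarrow> \<Union>U `` {x} = \<Union>U `` {y}"
  using closed_equiv equiv_class_eq by fast

lemma closed_converse: assumes "closed_subset S U" "s \<in> U" shows "s\<inverse> \<in> U"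
proof -
  have s: "s \<in> S" using assms closed_subset_subset by blast
  then obtain x y where xy: "(x, y) \<in> s" by (rule rel_nonempty)
  then have "(y, x) \<in> \<Union>U" using closed_sym assms by blast
  then show ?thesis
    using in_Union_iff[OF closed_subset_subset[OF assms(1)] converse_in[OF s]] xy by blast
qed

lemma closed_S: "closed_subset S S"
  using Id_in Union_S by (intro closed_subsetI) auto

lemma closed_Int: assumes "closed_subset S P" "closed_subset S Q" shows "closed_subset S (P \<inter> Q)"
proof (rule closed_subsetI)
  show sub: "P \<inter> Q \<subseteq> S" using assms closed_subset_subset by blast
  show "Id_on X \<in> P \<inter> Q" using assms closed_Id by blast
  show "\<Union>(P \<inter> Q) O \<Union>(P \<inter> Q) \<subseteq> \<Union>(P \<inter> Q)"
  proof (rule subrelI)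
    fix x z assume "(x, z) \<in> \<Union>(P \<inter> Q) O \<Union>(P \<inter> Q)"
    then have P: "(x, z) \<in> \<Union>P" and Q: "(x, z) \<in> \<Union>Q"
      using closed_trans[OF assms(1), of x _ z] closed_trans[OF assms(2), of x _ z] by auto
    then obtain s where s: "s \<in> P" "(x, z) \<in> s" by blast
    then have "s \<in> S" using closed_subset_subset[OF assms(1)] by blast
    then have "s \<in> Q" using in_Union_iff[OF closed_subset_subset[OF assms(2)] _ s(2)] Q by blast
    then show "(x, z) \<in> \<Union>(P \<inter> Q)" using s by blast
  qed
qed

text \<open>Commutativity turns \<open>PQPQ\<close> into \<open>PPQQ\<close>, which is contained in
  \<open>PQ\<close> as both factors are closed. Each factor lies in \<open>PQ\<close> because the
  other one contains the diagonal.\<close>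

lemma closed_complex_product:
  assumes "closed_subset S P" "closed_subset S Q"
  shows "closed_subset S (complex_product S P Q)"
    and "P \<subseteq> complex_product S P Q" and "Q \<subseteq> complex_product S P Q"
proof -
  note sub = assms[THEN closed_subset_subset]
  note eq = Union_complex_product[OF sub]
  have "\<Union>P \<subseteq> \<Union>P O \<Union>Q"
  proof (rule subrelI)
    fix x y assume xy: "(x, y) \<in> \<Union>P"
    then have "(y, y) \<in> \<Union>Q" using closed_refl[OF assms(2)] Union_in_X[OF sub(1)] by blast
    then show "(x, y) \<in> \<Union>P O \<Union>Q" using xy by blast
  qed
  then show P: "P \<subseteq> complex_product S P Q"
    using Union_subset_iff[OF sub(1) complex_product_subset] eq by metis
  have "\<Union>Q \<subseteq> \<Union>P O \<Union>Q"
  proof (rule subrelI)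
    fix x y assume xy: "(x, y) \<in> \<Union>Q"
    then have "(x, x) \<in> \<Union>P" using closed_refl[OF assms(1)] Union_in_X[OF sub(2)] by blast
    then show "(x, y) \<in> \<Union>P O \<Union>Q" using xy by blast
  qed
  then show "Q \<subseteq> complex_product S P Q"
    using Union_subset_iff[OF sub(2) complex_product_subset] eq by metis
  have "\<Union>P O \<Union>Q O \<Union>P O \<Union>Q = \<Union>P O \<Union>P O \<Union>Q O \<Union>Q"
    using Union_relcomp_commute[OF sub] by (metis O_assoc)
  also have "\<dots> \<subseteq> \<Union>P O \<Union>Q"
  proof (rule subrelI)
    fix x y assume "(x, y) \<in> \<Union>P O \<Union>P O \<Union>Q O \<Union>Q"
    then obtain a b c where "(x, a) \<in> \<Union>P" "(a, b) \<in> \<Union>P" "(b, c) \<in> \<Union>Q" "(c, y) \<in> \<Union>Q"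
      by (elim relcompE) blast
    then have "(x, b) \<in> \<Union>P" "(b, y) \<in> \<Union>Q"
      using closed_trans[OF assms(1)] closed_trans[OF assms(2)] by metis+
    then show "(x, y) \<in> \<Union>P O \<Union>Q" by (rule relcompI)
  qed
  finally show "closed_subset S (complex_product S P Q)"
    using P closed_Id[OF assms(1)] complex_product_subset
    by (intro closed_subsetI) (auto simp: eq O_assoc)
qed

section \<open>Homogeneous closed subsets: extension, and passage to a permutation group\<close>

text \<open>The map \<open>f\<close> is any function, constrained only on the coset of
  \<open>x\<close>. For closed \<open>U\<close> its injectivity there is automatic: if two points
  had equal images, the relation between them would contain a diagonal pair.\<close>

definition homogeneous :: "'a rel set \<Rightarrow> bool" where
  "homogeneous U \<longleftrightarrow> (\<forall>s\<in>U. \<forall>(x, y)\<in>s. \<forall>(x', y')\<in>s. \<exists>f. f x = x' \<and> f y = y' \<and>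
     (\<forall>u\<in>\<Union>U `` {x}. \<forall>v\<in>\<Union>U `` {x}. \<forall>t\<in>U. (u, v) \<in> t \<longrightarrow> (f u, f v) \<in> t))"

lemma homogeneousD:
  assumes "homogeneous U" "s \<in> U" "(x, y) \<in> s" "(x', y') \<in> s"
  shows "\<exists>f. f x = x' \<and> f y = y' \<and>
     (\<forall>u\<in>\<Union>U `` {x}. \<forall>v\<in>\<Union>U `` {x}. \<forall>t\<in>U. (u, v) \<in> t \<longrightarrow> (f u, f v) \<in> t)"
  using assms(1)[unfolded homogeneous_def, THEN bspec, OF assms(2), THEN bspec, OF assms(3),
      unfolded prod.case, THEN bspec, OF assms(4), unfolded prod.case] .

text \<open>Cosets of the diagonal are single points, so a constant map serves.\<close>

lemma homogeneous_diagonal: "homogeneous {Id_on X}"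
proof -
  have "\<exists>f. f x = x' \<and> f x = x' \<and> (\<forall>u\<in>\<Union>{Id_on X} `` {x}. \<forall>v\<in>\<Union>{Id_on X} `` {x}.
      \<forall>t\<in>{Id_on X}. (u, v) \<in> t \<longrightarrow> (f u, f v) \<in> t)" if "x' \<in> X" for x x'
    using that by (intro exI[of _ "\<lambda>_. x'"]) auto
  then show ?thesis unfolding homogeneous_def by auto
qed

lemma closed_diagonal: "closed_subset S {Id_on X}"
  using Id_in by (intro closed_subsetI) auto

text \<open>Modulo \<open>B\<close> both relations are single valued. The two intermediate points
  share a \<open>B\<close>-coset because of \<open>s\<inverse> O s\<close>; commutativity moves
  \<open>B\<close> past \<open>t\<close>, and \<open>t\<inverse> O t\<close> handles the
  rest.\<close>

lemma relcomp_single_class: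
  assumes B: "closed_subset S B" and "s \<in> S" "t \<in> S"
    and "s\<inverse> O s \<subseteq> \<Union>B" "t\<inverse> O t \<subseteq> \<Union>B"
    and "(x, y) \<in> s O t" "(x, y') \<in> s O t"
  shows "(y, y') \<in> \<Union>B"
proof -
  obtain z z' where z: "(x, z) \<in> s" "(z, y) \<in> t" "(x, z') \<in> s" "(z', y') \<in> t"
    using assms by blast
  then have "(z, z') \<in> \<Union>B" using assms by blast
  then have "(y, y') \<in> t\<inverse> O \<Union>B O t" using z by blast
  also have "\<Union>B O t = t O \<Union>B"
    using relcomp_Union_commute[OF closed_subset_subset[OF B] assms(3)] .
  finally have "(y, y') \<in> (t\<inverse> O t) O \<Union>B" by (simp add: O_assoc)
  then have "(y, y') \<in> \<Union>B O \<Union>B" using assms(5) by blast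
  then show ?thesis using closed_trans[OF B] by (elim relcompE) auto
qed

text \<open>From \<open>x\<close>, the product \<open>s O t\<close> reaches points of a single
  \<open>B\<close>-coset only, and \<open>m\<close> reaches that whole coset from \<open>x\<close>.
  So \<open>s O t\<close> can contain no pair outside \<open>m\<close>.\<close>

lemma relcomp_determined:
  assumes B: "closed_subset S B" and s: "s \<in> S" "s\<inverse> O s \<subseteq> \<Union>B" and t: "t \<in> S" "t\<inverse> O t \<subseteq> \<Union>B"
    and m: "m \<in> S" "m O \<Union>B \<subseteq> m" "(x, y) \<in> m"
    and xy: "(x, y) \<in> s O t" and xy': "(x', y') \<in> s O t"
  shows "(x', y') \<in> m"
proof -
  have "x' \<in> X" "y' \<in> X" using in_X[OF s(1)] in_X[OF t(1)] xy' by auto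
  then obtain m' where m': "m' \<in> S" "(x', y') \<in> m'" by (rule rel_ex)
  have "x \<in> X" using in_X(1)[OF m(1,3)] .
  \<comment> \<open>The relation of \<open>(x', y')\<close> is realised again from \<open>x\<close>,
    where it can be compared with \<open>m\<close>.\<close>
  then obtain z where z: "(x, z) \<in> m'" using successor m' by blast
  have "(x, z) \<in> s O t" using relcomp_transfer[OF s(1) t(1) m' z xy'] .
  then have "(y, z) \<in> \<Union>B" using relcomp_single_class[OF B s(1) t(1) s(2) t(2) xy] by blast
  then have "(x, z) \<in> m" using m by blast
  then have "m = m'" using rel_unique[OF m(1) m'(1)] z by blast
  then show ?thesis using m' by simp
qed

text \<open>Each \<open>A\<close>-coset \<open>C\<close> in \<open>xM\<close> gets a base point \<open>rep C\<close>, which is \<open>x\<close> or \<open>w\<close> when possible, and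
  \<open>targ\<close> prescribes the images of the base points. The glued map \<open>g\<close> preserves the relation of \<open>x\<close> to
  every point exactly, hence by \<open>relcomp_determined\<close> all relations outside \<open>A\<close>.\<close>

lemma homogeneous_extend:
  assumes A: "closed_subset S A" and M: "closed_subset S M" and B: "closed_subset S B"
    and AM: "A \<subseteq> M" and hA: "homogeneous A"
    and thin: "\<And>m. m \<in> M \<Longrightarrow> m\<inverse> O m \<subseteq> \<Union>B"
    and absorb: "\<And>m. m \<in> M - A \<Longrightarrow> m O \<Union>B \<subseteq> m"
  shows "homogeneous M"
  unfolding homogeneous_def
proof (intro ballI, clarify)
  fix s x w x' w' assume s: "s \<in> M" and xw: "(x, w) \<in> s" and xw': "(x', w') \<in> s"
  note MS = closed_subset_subset[OF M] and AS = closed_subset_subset[OF A]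
  have X: "x \<in> X" "w \<in> X" "x' \<in> X" "w' \<in> X" using s xw xw' MS in_X by blast+
  let ?A = "\<lambda>u. \<Union>A `` {u}"
  define rep where "rep C = (if x \<in> C then x else if w \<in> C then w else SOME u. u \<in> C)" for C
  have rep: "rep C \<in> C" if "u \<in> C" for u C
    using someI[of "\<lambda>u. u \<in> C", OF that] unfolding rep_def by simp
  \<comment> \<open>The image of \<open>w\<close> is forced. Any other point goes to an arbitrary
    point that is related to \<open>x'\<close> as the point is to \<open>x\<close>; this sends
    \<open>x\<close> to \<open>x'\<close>.\<close>
  define targ where
    "targ y = (if y = w then w' else SOME y'. \<forall>m\<in>M. (x, y) \<in> m \<longrightarrow> (x', y') \<in> m)" for y
  have targ: "(x', targ y) \<in> m" if m: "m \<in> M" and xy: "(x, y) \<in> m" for m y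
  proof (cases "y = w")
    case True
    then have "m = s" using rel_unique[of m s x w] m s xw xy MS by blast
    then show ?thesis using True xw' unfolding targ_def by simp
  next
    case False
    obtain y' where "(x', y') \<in> m" using successor m MS X by blast
    moreover have "n = m" if "n \<in> M" "(x, y) \<in> n" for n
      using rel_unique[of n m x y] that m xy MS by blast
    ultimately have "\<forall>n\<in>M. (x, y) \<in> n \<longrightarrow> (x', y') \<in> n" by blast
    then have "\<forall>n\<in>M. (x, y) \<in> n \<longrightarrow> (x', targ y) \<in> n"
      unfolding targ_def if_not_P[OF False] by (rule someI)
    then show ?thesis using m xy by blast
  qed
  have targ_x: "targ x = x'" using targ[OF closed_Id[OF M], of x] X by auto
  have targ_w: "targ w = w'" unfolding targ_def by simp
  have "\<exists>f. f (rep (?A y)) = targ (rep (?A y)) \<and> (w \<in> ?A y \<longrightarrow> f w = w') \<and>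
      (\<forall>u\<in>?A y. \<forall>v\<in>?A y. \<forall>t\<in>A. (u, v) \<in> t \<longrightarrow> (f u, f v) \<in> t)" if y: "(x, y) \<in> \<Union>M" for y
  proof -
    have yX: "y \<in> X" using y Union_in_X[OF MS] by blast
    let ?r = "rep (?A y)"
    have r: "(y, ?r) \<in> \<Union>A" using rep[of y "?A y"] closed_refl[OF A yX] by simp
    then have Ar: "?A ?r = ?A y" using closed_class_eq[OF A r] by simp
    show ?thesis
    \<comment> \<open>Two images are prescribed only in a coset containing both \<open>x\<close> and
      \<open>w\<close>; then \<open>s\<close> lies in \<open>A\<close>, and homogeneity of
      \<open>A\<close> applies to the pair \<open>(x, w)\<close>. In any other coset it applies to
      the diagonal pair of the base point, which is \<open>w\<close> if the coset contains
      \<open>w\<close>.\<close>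
    proof (cases "x \<in> ?A y \<and> w \<in> ?A y")
      case True
      then have rx: "?r = x" unfolding rep_def by simp
      then have "(x, w) \<in> \<Union>A" using Ar[unfolded rx] True by (metis Image_singleton_iff)
      then have sA: "s \<in> A" using in_Union_iff[OF AS subsetD[OF MS s] xw] by simp
      obtain f where "f x = x'" "f w = w'"
        "\<And>u v t. u \<in> ?A x \<Longrightarrow> v \<in> ?A x \<Longrightarrow> t \<in> A \<Longrightarrow> (u, v) \<in> t \<Longrightarrow> (f u, f v) \<in> t"
        using homogeneousD[OF hA sA xw xw'] by blast
      then show ?thesis using Ar unfolding rx targ_x by (intro exI[of _ f]) auto
    next
      case False
      have "(x, ?r) \<in> \<Union>M" using closed_trans[OF M y, of ?r] r AM by blast
      then obtain n where n: "n \<in> M" "(x, ?r) \<in> n" by blast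
      then have tX: "targ ?r \<in> X" using in_X(2)[OF subsetD[OF MS n(1)] targ[OF n]] by blast
      have "?r \<in> X" using r Union_in_X[OF AS] by blast
      then have rt: "(?r, ?r) \<in> Id_on X" "(targ ?r, targ ?r) \<in> Id_on X" using tX by auto
      obtain f where f: "f ?r = targ ?r" "f ?r = targ ?r"
        "\<And>u v t. u \<in> ?A ?r \<Longrightarrow> v \<in> ?A ?r \<Longrightarrow> t \<in> A \<Longrightarrow> (u, v) \<in> t \<Longrightarrow> (f u, f v) \<in> t"
        using homogeneousD[OF hA closed_Id[OF A] rt] by blast
      have "f w = w'" if w: "w \<in> ?A y"
      proof -
        have "?r = w" using w False unfolding rep_def by auto
        then show ?thesis using f(1) targ_w by simp
      qed
      then show ?thesis using f Ar by (intro exI[of _ f]) auto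
    qed
  qed
  \<comment> \<open>The maps are chosen per coset and not per point, so that all points of a coset
    share one map.\<close>
  then have "\<forall>C \<in> ?A ` (\<Union>M `` {x}). \<exists>f. f (rep C) = targ (rep C) \<and> (w \<in> C \<longrightarrow> f w = w') \<and>
      (\<forall>u\<in>C. \<forall>v\<in>C. \<forall>t\<in>A. (u, v) \<in> t \<longrightarrow> (f u, f v) \<in> t)"
    by auto
  from bchoice[OF this] obtain F where F0: "\<forall>C \<in> ?A ` (\<Union>M `` {x}). F C (rep C) = targ (rep C) \<and>
      (w \<in> C \<longrightarrow> F C w = w') \<and> (\<forall>u\<in>C. \<forall>v\<in>C. \<forall>t\<in>A. (u, v) \<in> t \<longrightarrow> (F C u, F C v) \<in> t)"
    by blast
  have F: "F C (rep C) = targ (rep C) \<and>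
      (w \<in> C \<longrightarrow> F C w = w') \<and> (\<forall>u\<in>C. \<forall>v\<in>C. \<forall>t\<in>A. (u, v) \<in> t \<longrightarrow> (F C u, F C v) \<in> t)"
    if "C = ?A y" "(x, y) \<in> \<Union>M" for C y
    using bspec[OF F0, of C] that by blast
  define g where "g u = F (?A u) u" for u
  have g_rel: "(g u, g v) \<in> t" if "(x, u) \<in> \<Union>M" "(u, v) \<in> t" "t \<in> A" for u v t
  proof -
    have uv: "(u, v) \<in> \<Union>A" using that by blast
    then have v: "?A v = ?A u" "v \<in> ?A u" using closed_class_eq[OF A uv] by auto
    have "u \<in> X" using that(1) Union_in_X[OF MS] by blast
    then have "u \<in> ?A u" using closed_refl[OF A] by simp
    then show ?thesis using F[OF refl that(1)] that(2,3) v unfolding g_def by simp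
  qed
  have xM: "(x, x) \<in> \<Union>M" "(x, w) \<in> \<Union>M" using closed_refl[OF M X(1)] s xw by auto
  have "x \<in> ?A x" using closed_refl[OF A X(1)] by simp
  then have gx: "g x = x'"
    using F[OF refl xM(1)] targ_x unfolding g_def rep_def by simp
  have "w \<in> ?A w" using closed_refl[OF A X(2)] by simp
  then have gw: "g w = w'" using F[OF refl xM(2)] unfolding g_def by simp
  have g_base: "(x', g u) \<in> m" if m: "m \<in> M" "(x, u) \<in> m" for u m
  proof (cases "m \<in> A")
    case True
    then show ?thesis using g_rel[OF xM(1) m(2) True] gx by simp
  next
    case False
    \<comment> \<open>The path from \<open>x\<close> to \<open>u\<close> through the base point is
      carried by \<open>g\<close> to a path along the same relations \<open>n\<close> and
      \<open>a\<close>, and \<open>n O a\<close> contains only pairs of \<open>m\<close>.\<close>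
    let ?r = "rep (?A u)"
    have xu: "(x, u) \<in> \<Union>M" using m by blast
    then have uX: "u \<in> X" using Union_in_X[OF MS] by blast
    have "u \<in> ?A u" using closed_refl[OF A uX] by simp
    then have r: "(u, ?r) \<in> \<Union>A" using rep[of u "?A u"] by simp
    then have Ar: "?A ?r = ?A u" using closed_class_eq[OF A r] by simp
    have xr: "(x, ?r) \<in> \<Union>M" using closed_trans[OF M xu, of ?r] r AM by blast
    obtain n where n: "n \<in> M" "(x, ?r) \<in> n" using xr by blast
    obtain a where a: "a \<in> A" "(?r, u) \<in> a" using closed_sym[OF A r] by blast
    have gr: "g ?r = targ ?r" using F[OF refl xu] Ar unfolding g_def by simp
    have "(x', g ?r) \<in> n" using targ[OF n] gr by simp
    moreover have "(g ?r, g u) \<in> a" using g_rel[OF xr a(2,1)] .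
    ultimately have "(x', g u) \<in> n O a" by blast
    moreover have "(x, u) \<in> n O a" using n a by blast
    ultimately show ?thesis
      using relcomp_determined[OF B subsetD[OF MS n(1)] thin[OF n(1)] subsetD[OF AS a(1)]
          thin[OF subsetD[OF AM a(1)]] subsetD[OF MS m(1)] absorb[of m] m(2)] m(1) False by simp
  qed
  have "(g u, g v) \<in> t" if uv: "u \<in> \<Union>M `` {x}" "v \<in> \<Union>M `` {x}" "t \<in> M" "(u, v) \<in> t" for u v t
  proof (cases "t \<in> A")
    case True
    then show ?thesis using g_rel uv by blast
  next
    case False
    \<comment> \<open>The path from \<open>u\<close> back to \<open>x\<close> and on to
      \<open>v\<close> plays the same role for \<open>(u, v)\<close>.\<close>
    obtain h k where h: "h \<in> M" "(x, u) \<in> h" and k: "k \<in> M" "(x, v) \<in> k" using uv by blast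
    have h': "h\<inverse> \<in> M" using closed_converse[OF M h(1)] .
    have "(u, v) \<in> h\<inverse> O k" "(g u, g v) \<in> h\<inverse> O k"
      using h k g_base[OF h] g_base[OF k] by blast+
    then show ?thesis
      using relcomp_determined[OF B subsetD[OF MS h'] thin[OF h'] subsetD[OF MS k(1)]
          thin[OF k(1)] subsetD[OF MS uv(3)] absorb[of t] uv(4)] uv(3) False by simp
  qed
  then show "\<exists>f. f x = x' \<and> f w = w' \<and>
     (\<forall>u\<in>\<Union>M `` {x}. \<forall>v\<in>\<Union>M `` {x}. \<forall>t\<in>M. (u, v) \<in> t \<longrightarrow> (f u, f v) \<in> t)"
    using gx gw by blast
qed

text \<open>The group consists of all permutations of \<open>X\<close> that preserve every relation
  in \<open>S\<close>. Homogeneity provides enough of them to make each relation a single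
  orbit.\<close>

lemma homogeneous_imp_schurian:
  assumes "homogeneous S" shows "schurian X S"
proof -
  define G where "G = {g \<in> Bij X. \<forall>s\<in>S. \<forall>(u, v)\<in>s. (g u, g v) \<in> s}"
  have G: "g \<in> Bij X" "s \<in> S \<Longrightarrow> (u, v) \<in> s \<Longrightarrow> (g u, g v) \<in> s" if "g \<in> G" for g s u v
    using that unfolding G_def by auto
  have GI: "g \<in> G" if "g \<in> Bij X" "\<And>s u v. s \<in> S \<Longrightarrow> (u, v) \<in> s \<Longrightarrow> (g u, g v) \<in> s" for g
    using that unfolding G_def by blast
  have "subgroup G (BijGroup X)"
  proof
    show "G \<subseteq> carrier (BijGroup X)" unfolding G_def BijGroup_def by auto
    show "f \<otimes>\<^bsub>BijGroup X\<^esub> g \<in> G" if f: "f \<in> G" and g: "g \<in> G" for f g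
    proof (rule GI)
      show "f \<otimes>\<^bsub>BijGroup X\<^esub> g \<in> Bij X"
        using G(1)[OF f] G(1)[OF g] unfolding BijGroup_def by (simp add: compose_Bij)
      fix s u v assume "s \<in> S" "(u, v) \<in> s"
      moreover from this have "u \<in> X" "v \<in> X" using in_X by blast+
      ultimately show "((f \<otimes>\<^bsub>BijGroup X\<^esub> g) u, (f \<otimes>\<^bsub>BijGroup X\<^esub> g) v) \<in> s"
        using G[OF f] G[OF g] unfolding BijGroup_def by (simp add: compose_def)
    qed
    show "\<one>\<^bsub>BijGroup X\<^esub> \<in> G"
      by (rule GI) (use in_X in \<open>auto simp: BijGroup_def id_Bij\<close>)
    show "inv\<^bsub>BijGroup X\<^esub> g \<in> G" if g: "g \<in> G" for g
    proof (rule GI)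
      note bij = G(1)[OF g]
      show "inv\<^bsub>BijGroup X\<^esub> g \<in> Bij X"
        using bij by (simp add: inv_BijGroup restrict_inv_into_Bij)
      fix s u v assume s: "s \<in> S" "(u, v) \<in> s"
      then have uv: "u \<in> X" "v \<in> X" using in_X by blast+
      let ?u = "inv_into X g u" and ?v = "inv_into X g v"
      \<comment> \<open>The relation \<open>t\<close> of the preimages is preserved by
        \<open>g\<close>, hence contains \<open>(u, v)\<close> and equals \<open>s\<close>.\<close>
      have "?u \<in> X" "?v \<in> X" using Bij_inv_into_mem[OF bij] uv by blast+
      then obtain t where t: "t \<in> S" "(?u, ?v) \<in> t" by (rule rel_ex)
      have "g ?u = u" "g ?v = v"
        using bij uv unfolding Bij_def bij_betw_def by (auto intro: f_inv_into_f)
      then have "(u, v) \<in> t" using G(2)[OF g t] by simp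
      then have "t = s" using rel_unique t s by metis
      then show "((inv\<^bsub>BijGroup X\<^esub> g) u, (inv\<^bsub>BijGroup X\<^esub> g) v) \<in> s"
        using t bij uv by (simp add: inv_BijGroup)
    qed
  qed
  moreover have ex: "\<exists>g\<in>G. g x = x' \<and> g y = y'" if s: "s \<in> S" "(x, y) \<in> s" "(x', y') \<in> s" for s x y x' y'
  proof -
    obtain f where f: "f x = x'" "f y = y'"
      "\<And>u v t. u \<in> \<Union>S `` {x} \<Longrightarrow> v \<in> \<Union>S `` {x} \<Longrightarrow> t \<in> S \<Longrightarrow> (u, v) \<in> t \<Longrightarrow> (f u, f v) \<in> t"
      using homogeneousD[OF assms s] by blast
    have xy: "x \<in> X" "y \<in> X" using s in_X by blast+
    then have SX: "\<Union>S `` {x} = X" unfolding Union_S by auto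
    have f': "(f u, f v) \<in> t" if "t \<in> S" "(u, v) \<in> t" for u v t
      using f(3)[of u v t] in_X[OF that] that unfolding SX by blast
    have fX: "f ` X \<subseteq> X" using f'[OF Id_in] by auto
    moreover have "inj_on f X"
    proof (rule inj_onI)
      fix u v assume uv: "u \<in> X" "v \<in> X" "f u = f v"
      obtain t where t: "t \<in> S" "(u, v) \<in> t" using rel_ex uv by metis
      have Id: "(f u, f v) \<in> Id_on X" using uv fX by auto
      have "t = Id_on X" by (rule rel_unique[OF t(1) Id_in f'[OF t] Id])
      then show "u = v" using t by auto
    qed
    ultimately have "bij_betw f X X"
      using finite_X by (simp add: bij_betw_def endo_inj_surj)
    \<comment> \<open>Members of \<open>Bij X\<close> are extensional, which \<open>f\<close> need
      not be.\<close>
    then have "restrict f X \<in> Bij X" unfolding Bij_def by (simp add: bij_betw_restrict_eq)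
    then have "restrict f X \<in> G"
    proof (rule GI)
      fix s u v assume "s \<in> S" "(u, v) \<in> s"
      then show "(restrict f X u, restrict f X v) \<in> s" using f' in_X by auto
    qed
    then show ?thesis using f xy by (intro bexI[of _ "restrict f X"]) auto
  qed
  moreover have "\<exists>g\<in>G. g x = y" if "x \<in> X" "y \<in> X" for x y
    using ex[OF Id_in, of x x y y] that by auto
  moreover have "S = orbits ((BijGroup X)\<lparr>carrier := G\<rparr>) (X \<times> X) (\<lambda>g. map_prod g g)"
  proof -
    have orb: "orbit ((BijGroup X)\<lparr>carrier := G\<rparr>) (\<lambda>g. map_prod g g) (x, y) = s"
      if s: "s \<in> S" "(x, y) \<in> s" for s x y
      using G(2)[OF _ s] ex[OF s] unfolding orbit_def by force
    have "s \<in> orbits ((BijGroup X)\<lparr>carrier := G\<rparr>) (X \<times> X) (\<lambda>g. map_prod g g)" if s: "s \<in> S" for s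
    proof -
      obtain x y where xy: "(x, y) \<in> s" using s by (rule rel_nonempty)
      then have "x \<in> X" "y \<in> X" using s in_X by blast+
      then show ?thesis unfolding orbits_def using orb[OF s xy] by blast
    qed
    moreover have "orbit ((BijGroup X)\<lparr>carrier := G\<rparr>) (\<lambda>g. map_prod g g) (x, y) \<in> S"
      if xy: "x \<in> X" "y \<in> X" for x y
    proof -
      obtain s where s: "s \<in> S" "(x, y) \<in> s" using xy by (rule rel_ex)
      then show ?thesis using orb[OF s] by simp
    qed
    ultimately show ?thesis unfolding orbits_def by (intro equalityI subsetI) auto
  qed
  ultimately show ?thesis unfolding schurian_def by blast
qed

section \<open>Counting cosets\<close>

lemma classes_disjoint:
  assumes "closed_subset S A" "D \<in> (\<lambda>y. \<Union>A `` {y}) ` Y" "E \<in> (\<lambda>y. \<Union>A `` {y}) ` Y" "D \<noteq> E"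
  shows "D \<inter> E = {}"
proof (rule ccontr)
  assume "D \<inter> E \<noteq> {}"
  then obtain w where w: "w \<in> D" "w \<in> E" by blast
  obtain y z where D: "D = \<Union>A `` {y}" and E: "E = \<Union>A `` {z}" using assms(2,3) by blast
  have "(y, w) \<in> \<Union>A" "(z, w) \<in> \<Union>A" using w D E by auto
  then have "D = \<Union>A `` {w}" "E = \<Union>A `` {w}" using closed_class_eq[OF assms(1)] D E by metis+
  then show False using assms(4) by simp
qed

lemma finite_class: "U \<subseteq> S \<Longrightarrow> finite (\<Union>U `` Y)"
  by (rule finite_subset[OF _ finite_X]) (use Union_in_X in blast)

lemma scheme_order_pos: assumes "closed_subset S A" shows "scheme_order X A > 0"
proof -
  obtain x where x: "x \<in> X" using X_nonempty by blast
  have "x \<in> \<Union>A `` {x}" using closed_refl[OF assms x] by simp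
  then have "card (\<Union>A `` {x}) > 0"
    using finite_class[OF closed_subset_subset[OF assms]] by (metis card_gt_0_iff empty_iff)
  then show ?thesis using scheme_order_eq[OF closed_subset_subset[OF assms] x] by simp
qed

lemma card_union_of_classes:
  assumes A: "closed_subset S A" and Y: "Y \<subseteq> X"
  shows "card (\<Union>A `` Y) = card ((\<lambda>y. \<Union>A `` {y}) ` Y) * scheme_order X A"
proof -
  let ?C = "(\<lambda>y. \<Union>A `` {y}) ` Y"
  note sub = closed_subset_subset[OF A]
  have "\<Union>A `` Y = (\<Union>D\<in>?C. D)" by blast
  also have "card \<dots> = (\<Sum>D\<in>?C. card D)"
  proof (rule card_UN_disjoint)
    show "finite ?C" using Y finite_X finite_subset by blast
    show "\<forall>D\<in>?C. finite D" using finite_class[OF sub] by blast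
    show "\<forall>D\<in>?C. \<forall>E\<in>?C. D \<noteq> E \<longrightarrow> D \<inter> E = {}" using classes_disjoint[OF A] by simp
  qed
  also have "\<dots> = (\<Sum>D\<in>?C. scheme_order X A)"
    using scheme_order_eq[OF sub] Y by (intro sum.cong refl) auto
  finally show ?thesis by simp
qed

text \<open>Lagrange's theorem: a coset of \<open>R\<close> is a disjoint union of cosets of
  \<open>K\<close>, all of the same size.\<close>

lemma scheme_order_dvd:
  assumes "closed_subset S K" "closed_subset S R" "K \<subseteq> R"
  shows "scheme_order X K dvd scheme_order X R"
proof -
  obtain x where x: "x \<in> X" using X_nonempty by blast
  note RS = closed_subset_subset[OF assms(2)]
  let ?Y = "\<Union>R `` {x}"
  have Y: "?Y \<subseteq> X" using Union_in_X[OF RS] by blast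
  have "\<Union>K `` ?Y = ?Y"
  proof
    show "\<Union>K `` ?Y \<subseteq> ?Y" using closed_trans[OF assms(2), of x] assms(3) by blast
    show "?Y \<subseteq> \<Union>K `` ?Y" using closed_refl[OF assms(1)] Y by blast
  qed
  then show ?thesis
    using card_union_of_classes[OF assms(1) Y] scheme_order_eq[OF RS x] by simp
qed

text \<open>At every point the smaller coset fills the larger one, and each relation in
  \<open>R\<close> occurs at some point.\<close>

lemma eq_of_scheme_order_eq:
  assumes "K \<subseteq> R" "R \<subseteq> S" "scheme_order X K = scheme_order X R"
  shows "K = R"
proof
  show "R \<subseteq> K"
  proof
    fix s assume s: "s \<in> R"
    then have "s \<in> S" using assms by blast
    then obtain x y where xy: "(x, y) \<in> s" by (rule rel_nonempty)
    have x: "x \<in> X" using in_X(1)[OF \<open>s \<in> S\<close> xy] .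
    have KS: "K \<subseteq> S" using assms by blast
    have "\<Union>K `` {x} = \<Union>R `` {x}"
    proof (rule card_subset_eq)
      show "finite (\<Union>R `` {x})" using finite_class[OF assms(2)] .
      show "\<Union>K `` {x} \<subseteq> \<Union>R `` {x}" using assms(1) by blast
      show "card (\<Union>K `` {x}) = card (\<Union>R `` {x})"
        using scheme_order_eq[OF KS x] scheme_order_eq[OF assms(2) x] assms(3) by simp
    qed
    then have "(x, y) \<in> \<Union>K" using xy s by blast
    then show "s \<in> K" using in_Union_iff[OF KS \<open>s \<in> S\<close> xy] by simp
  qed
qed (fact assms)

text \<open>The right-hand side does not mention \<open>z\<close>: the \<open>s\<close>-successors
  of \<open>x\<close> are spread evenly over the \<open>A\<close>-cosets that contain any of
  them.\<close>

lemma card_Int_class: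
  assumes A: "A \<subseteq> S" and s: "s \<in> S" "(x, z) \<in> s"
  shows "card (s `` {x} \<inter> \<Union>A `` {z}) = (\<Sum>a\<in>A. structure_constant s (a\<inverse>) s)"
proof -
  have "s `` {x} \<inter> \<Union>A `` {z} = (\<Union>a\<in>A. s `` {x} \<inter> a `` {z})" by blast
  also have "card \<dots> = (\<Sum>a\<in>A. card (s `` {x} \<inter> a `` {z}))"
  proof (rule card_UN_disjoint)
    show "finite A" using A finite_S finite_subset by blast
    show "\<forall>a\<in>A. finite (s `` {x} \<inter> a `` {z})" using finite_Image[OF s(1)] by blast
    show "\<forall>a\<in>A. \<forall>b\<in>A. a \<noteq> b \<longrightarrow> (s `` {x} \<inter> a `` {z}) \<inter> (s `` {x} \<inter> b `` {z}) = {}"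
      using A rel_unique by blast
  qed
  also have "\<dots> = (\<Sum>a\<in>A. structure_constant s (a\<inverse>) s)"
  proof (rule sum.cong[OF refl])
    fix a assume "a \<in> A"
    then have "a\<inverse> \<in> S" using A converse_in by blast
    then show "card (s `` {x} \<inter> a `` {z}) = structure_constant s (a\<inverse>) s"
      using structure_constant_eq[OF s(1) _ s(1) s(2), of "a\<inverse>"] by simp
  qed
  finally show ?thesis .
qed

lemma closed_residue_subset:
  assumes "closed_subset S A" "s \<in> A" shows "s\<inverse> O s \<subseteq> \<Union>A"
proof (rule subrelI)
  fix y z assume "(y, z) \<in> s\<inverse> O s"
  then obtain x where "(x, y) \<in> \<Union>A" "(x, z) \<in> \<Union>A" using assms(2) by blast
  then show "(y, z) \<in> \<Union>A" using closed_trans[OF assms(1) closed_sym[OF assms(1)]] by blast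
qed

text \<open>The number \<open>m\<close> of \<open>A\<close>-cosets meeting \<open>xs\<close> divides \<open>n\<^sub>s\<close>, because \<open>xs\<close> meets all of them
  equally often, and \<open>m < p\<close>, because \<open>xs\<close> avoids \<open>xA\<close>. Hence \<open>m = 1\<close>.\<close>

lemma residue_subset_of_prime_index:
  assumes A: "closed_subset S A" and M: "closed_subset S M" and AM: "A \<subseteq> M"
    and p: "prime p" and idx: "scheme_order X M = p * scheme_order X A"
    and s: "s \<in> M" and val: "valency X s = p ^ k"
  shows "s\<inverse> O s \<subseteq> \<Union>A"
proof (cases "s \<in> A")
  case True
  then show ?thesis using closed_residue_subset[OF A] by blast
next
  case False
  note AS = closed_subset_subset[OF A] and MS = closed_subset_subset[OF M]
  have sS: "s \<in> S" using s MS by blast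
  show ?thesis
  proof (rule subrelI)
    fix y y' assume "(y, y') \<in> s\<inverse> O s"
    then obtain x where xy: "(x, y) \<in> s" "(x, y') \<in> s" by blast
    have x: "x \<in> X" using in_X(1)[OF sS xy(1)] .
    define Y where "Y = s `` {x}"
    define C where "C = (\<lambda>y. \<Union>A `` {y}) ` Y"
    have Y: "Y \<subseteq> X" unfolding Y_def using in_X(2)[OF sS] by blast
    then have finY: "finite Y" using finite_X finite_subset by blast
    have cov: "Y \<subseteq> \<Union>A `` Y" using closed_refl[OF A] Y by blast
    define c where "c = (\<Sum>a\<in>A. structure_constant s (a\<inverse>) s)"
    have "Y = (\<Union>D\<in>C. Y \<inter> D)" using cov unfolding C_def by blast
    then have "card Y = card (\<Union>D\<in>C. Y \<inter> D)" by simp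
    also have "\<dots> = (\<Sum>D\<in>C. card (Y \<inter> D))"
    proof (rule card_UN_disjoint)
      show "finite C" unfolding C_def using finY by simp
      show "\<forall>D\<in>C. finite (Y \<inter> D)" using finY by simp
      show "\<forall>D\<in>C. \<forall>E\<in>C. D \<noteq> E \<longrightarrow> (Y \<inter> D) \<inter> (Y \<inter> E) = {}"
        using classes_disjoint[OF A] unfolding C_def by blast
    qed
    also have "\<dots> = (\<Sum>D\<in>C. c)"
      using card_Int_class[OF AS sS] unfolding C_def c_def Y_def by (intro sum.cong refl) auto
    finally have "card C dvd card Y" by simp
    then have dvd: "card C dvd p ^ k" unfolding Y_def using valency_eq[OF sS x] val by simp
    have "\<Union>A `` Y \<subseteq> \<Union>M `` {x} - \<Union>A `` {x}"
    proof
      fix z assume "z \<in> \<Union>A `` Y"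
      then obtain w where w: "(x, w) \<in> s" "(w, z) \<in> \<Union>A" unfolding Y_def by blast
      have "(x, z) \<in> \<Union>M" using closed_trans[OF M, of x w z] w s AM by blast
      moreover have "(x, z) \<notin> \<Union>A"
      proof
        assume "(x, z) \<in> \<Union>A"
        then have "(x, w) \<in> \<Union>A" using closed_trans[OF A _ closed_sym[OF A w(2)]] by blast
        then show False using in_Union_iff[OF AS sS w(1)] False by simp
      qed
      ultimately show "z \<in> \<Union>M `` {x} - \<Union>A `` {x}" by simp
    qed
    then have "card (\<Union>A `` Y) \<le> card (\<Union>M `` {x} - \<Union>A `` {x})"
      using finite_class[OF MS] by (intro card_mono) auto
    also have "\<dots> = card (\<Union>M `` {x}) - card (\<Union>A `` {x})"
      using finite_class[OF AS] AM by (intro card_Diff_subset) auto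
    also have "\<dots> = p * scheme_order X A - scheme_order X A"
      using scheme_order_eq[OF MS x] scheme_order_eq[OF AS x] idx by simp
    finally have "card C * scheme_order X A \<le> (p - 1) * scheme_order X A"
      using card_union_of_classes[OF A Y] unfolding C_def by (simp add: diff_mult_distrib)
    then have "card C \<le> p - 1" using scheme_order_pos[OF A] by simp
    moreover obtain j where j: "card C = p ^ j" using dvd p by (meson divides_primepow_nat)
    moreover have "p > 1" using p prime_gt_1_nat by blast
    ultimately have "j = 0"
      using self_le_power[of p j] by (cases "j = 0") auto
    then have "card C = 1" using j by simp
    moreover have "\<Union>A `` {y} \<in> C" "\<Union>A `` {y'} \<in> C" unfolding C_def Y_def using xy by blast+
    ultimately have "\<Union>A `` {y} = \<Union>A `` {y'}" by (metis card_1_singletonE singletonD)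
    then show "(y, y') \<in> \<Union>A" using closed_refl[OF A in_X(2)[OF sS xy(2)]] by blast
  qed
qed

text \<open>All \<open>s\<close>-successors of a point lie in one \<open>B\<close>-coset; the
  valency bound makes them exhaust it, so moving inside the coset does not leave
  \<open>s\<close>.\<close>

lemma absorb_of_valency_ge:
  assumes B: "closed_subset S B" and s: "s \<in> S" "s\<inverse> O s \<subseteq> \<Union>B"
    and val: "scheme_order X B \<le> valency X s"
  shows "s O \<Union>B \<subseteq> s"
proof (rule subrelI)
  fix x z assume "(x, z) \<in> s O \<Union>B"
  then obtain y where xy: "(x, y) \<in> s" and yz: "(y, z) \<in> \<Union>B" by blast
  note BS = closed_subset_subset[OF B]
  have "s `` {x} = \<Union>B `` {y}"
  proof (rule card_seteq)
    show "finite (\<Union>B `` {y})" using finite_class[OF BS] .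
    show "s `` {x} \<subseteq> \<Union>B `` {y}" using s(2) xy by blast
    show "card (\<Union>B `` {y}) \<le> card (s `` {x})"
      using val scheme_order_eq[OF BS in_X(2)[OF s(1) xy]] valency_eq[OF s(1) in_X(1)[OF s(1) xy]]
      by simp
  qed
  then show "(x, z) \<in> s" using yz by blast
qed

text \<open>These are the elements that become thin modulo \<open>B\<close>. They are closed under
  products since \<open>relcomp_single_class\<close> applies to every relation inside a product of
  two of them. Bounds on residues can therefore be checked on generators.\<close>

lemma closed_residue:
  assumes B: "closed_subset S B"
  shows "closed_subset S {s \<in> S. s\<inverse> O s \<subseteq> \<Union>B}" (is "closed_subset S ?M")
proof (rule closed_subsetI)
  show "Id_on X \<in> ?M" using Id_in closed_refl[OF B] by auto
  show "\<Union>?M O \<Union>?M \<subseteq> \<Union>?M"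
  proof (rule subrelI)
    fix x z assume "(x, z) \<in> \<Union>?M O \<Union>?M"
    then obtain s t where s: "s \<in> S" "s\<inverse> O s \<subseteq> \<Union>B" and t: "t \<in> S" "t\<inverse> O t \<subseteq> \<Union>B"
      and xz: "(x, z) \<in> s O t" by blast
    have "x \<in> X" "z \<in> X" using xz in_X(1)[OF s(1)] in_X(2)[OF t(1)] by auto
    then obtain u where u: "u \<in> S" "(x, z) \<in> u" by (rule rel_ex)
    have "u\<inverse> O u \<subseteq> \<Union>B"
    proof (rule subrelI)
      fix a b assume "(a, b) \<in> u\<inverse> O u"
      then obtain w where "(w, a) \<in> u" "(w, b) \<in> u" by blast
      then have "(w, a) \<in> s O t" "(w, b) \<in> s O t"
        using relcomp_transfer[OF s(1) t(1) u _ xz] by blast+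
      then show "(a, b) \<in> \<Union>B" by (rule relcomp_single_class[OF B s(1) t(1) s(2) t(2)])
    qed
    then show "(x, z) \<in> \<Union>?M" using u by blast
  qed
qed blast

lemma complex_product_least:
  assumes M: "closed_subset S M" and "P \<subseteq> M" "Q \<subseteq> M" shows "complex_product S P Q \<subseteq> M"
proof -
  have "P \<subseteq> S" "Q \<subseteq> S" using assms closed_subset_subset[OF M] by blast+
  moreover have "\<Union>P O \<Union>Q \<subseteq> \<Union>M"
  proof (rule subrelI)
    fix x z assume "(x, z) \<in> \<Union>P O \<Union>Q"
    then obtain y where "(x, y) \<in> \<Union>M" "(y, z) \<in> \<Union>M" using assms(2,3) by blast
    then show "(x, z) \<in> \<Union>M" by (rule closed_trans[OF M])
  qed
  ultimately show ?thesis using complex_product_subset_iff[OF _ _ closed_subset_subset[OF M]] by metis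
qed

section \<open>The thin radical and stabilizers in it\<close>

lemma thin_single_valued:
  assumes "t \<in> thin_radical X S" "(x, y) \<in> t" "(x, z) \<in> t" shows "y = z"
proof -
  have t: "t \<in> S" "valency X t = 1" using assms unfolding thin_radical_def by auto
  then have "card (t `` {x}) = 1" using valency_eq[OF t(1) in_X(1)[OF t(1) assms(2)]] by simp
  then show ?thesis using assms(2,3) by (metis Image_singleton_iff card_1_singletonE singletonD)
qed

lemma thin_residue_diagonal:
  assumes "t \<in> thin_radical X S" shows "t\<inverse> O t \<subseteq> Id_on X"
proof -
  have "t \<in> S" using assms unfolding thin_radical_def by blast
  show ?thesis
  proof (rule subrelI)
    fix y z assume "(y, z) \<in> t\<inverse> O t"
    then obtain x where xy: "(x, y) \<in> t" "(x, z) \<in> t" by blast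
    then have "y = z" by (rule thin_single_valued[OF assms])
    then show "(y, z) \<in> Id_on X" using in_X(2)[OF \<open>t \<in> S\<close> xy(2)] by blast
  qed
qed

text \<open>Two thin steps lead from a point to a single end point, hence so does any relation
  inside their product.\<close>

lemma closed_thin_radical: "closed_subset S (thin_radical X S)" (is "closed_subset S ?T")
proof (rule closed_subsetI)
  show "?T \<subseteq> S" unfolding thin_radical_def by blast
  obtain x where x: "x \<in> X" using X_nonempty by blast
  then have "Id_on X `` {x} = {x}" by auto
  then have "valency X (Id_on X) = 1" using valency_eq[OF Id_in x] by simp
  then show "Id_on X \<in> ?T" unfolding thin_radical_def using Id_in by blast
  show "\<Union>?T O \<Union>?T \<subseteq> \<Union>?T"
  proof (rule subrelI)
    fix x z assume "(x, z) \<in> \<Union>?T O \<Union>?T"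
    then obtain s t where s: "s \<in> ?T" and t: "t \<in> ?T" and xz: "(x, z) \<in> s O t" by blast
    have st: "s \<in> S" "t \<in> S" using s t unfolding thin_radical_def by auto
    have X: "x \<in> X" "z \<in> X" using xz in_X(1)[OF st(1)] in_X(2)[OF st(2)] by auto
    then obtain u where u: "u \<in> S" "(x, z) \<in> u" by (rule rel_ex)
    have "w = z" if "(x, w) \<in> u" for w
    proof -
      have "(x, w) \<in> s O t" using relcomp_transfer[OF st u that xz] .
      then show ?thesis using xz thin_single_valued[OF s] thin_single_valued[OF t] by blast
    qed
    then have "u `` {x} = {z}" using u by blast
    then have "valency X u = 1" using valency_eq[OF u(1) X(1)] by simp
    then show "(x, z) \<in> \<Union>?T" using u unfolding thin_radical_def by blast
  qed
qed

text \<open>The extension step with the diagonal as both \<open>A\<close> and \<open>B\<close>; thin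
  elements have a diagonal residue, and absorbing the diagonal is trivial.\<close>

lemma homogeneous_thin_radical: "homogeneous (thin_radical X S)"
  by (rule homogeneous_extend[OF closed_diagonal closed_thin_radical closed_diagonal])
    (use closed_Id[OF closed_thin_radical] homogeneous_diagonal thin_residue_diagonal in auto)

text \<open>A product is a nonempty union of relations, so the inclusion amounts to equality: this
  is the stabilizer of \<open>s\<close> in the group of thin relations acting by
  multiplication.\<close>

definition thin_stabilizer :: "'a rel \<Rightarrow> 'a rel set" where
  "thin_stabilizer s = {t \<in> thin_radical X S. s O t \<subseteq> s}"

lemma thin_stabilizer_absorb: "s O \<Union>(thin_stabilizer s) \<subseteq> s"
  unfolding thin_stabilizer_def by blast

lemma closed_thin_stabilizer:
  assumes s: "s \<in> S"
  shows "closed_subset S (thin_stabilizer s)" (is "closed_subset S ?K")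
proof (rule closed_subsetI)
  let ?T = "thin_radical X S"
  note TS = closed_subset_subset[OF closed_thin_radical]
  show KS: "?K \<subseteq> S" using TS unfolding thin_stabilizer_def by blast
  show "Id_on X \<in> ?K" using closed_Id[OF closed_thin_radical] unfolding thin_stabilizer_def by auto
  show "\<Union>?K O \<Union>?K \<subseteq> \<Union>?K"
  proof (rule subrelI)
    fix x z assume "(x, z) \<in> \<Union>?K O \<Union>?K"
    then obtain t t' where t: "t \<in> ?K" and t': "t' \<in> ?K" and xz: "(x, z) \<in> t O t'" by blast
    have "(x, z) \<in> \<Union>?T O \<Union>?T" using xz t t' unfolding thin_stabilizer_def by blast
    then have "(x, z) \<in> \<Union>?T" using closed_trans[OF closed_thin_radical, of x _ z] by auto
    then obtain u where u: "u \<in> ?T" "(x, z) \<in> u" by blast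
    have "s O u \<subseteq> s"
    proof (rule subrelI)
      fix a b assume "(a, b) \<in> s O u"
      then obtain c where c: "(a, c) \<in> s" "(c, b) \<in> u" by blast
      have "(c, b) \<in> t O t'"
        using relcomp_transfer[OF subsetD[OF KS t] subsetD[OF KS t'] subsetD[OF TS u(1)] u(2) c(2) xz] .
      then show "(a, b) \<in> s" using c t t' unfolding thin_stabilizer_def by blast
    qed
    then show "(x, z) \<in> \<Union>?K" using u unfolding thin_stabilizer_def by blast
  qed
qed

text \<open>Suppose a thin \<open>t\<close> joins two \<open>s\<close>-successors of one point. By
  regularity, \<open>t\<close> leads from each \<open>s\<close>-successor of any point to another
  \<open>s\<close>-successor of that point; as \<open>t\<close> is single valued, it stabilizes
  \<open>s\<close>. Conversely, a stabilizing \<open>t\<close> joins \<open>s\<close>-successors of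
  any \<open>s\<close>-predecessor of \<open>y\<close>.\<close>

lemma residue_eq_thin_stabilizer:
  assumes s: "s \<in> S" and thin: "s\<inverse> O s \<subseteq> \<Union>(thin_radical X S)"
  shows "s\<inverse> O s = \<Union>(thin_stabilizer s)"
proof (intro equalityI subrelI)
  fix y z assume "(y, z) \<in> s\<inverse> O s"
  then obtain x where xy: "(x, y) \<in> s" "(x, z) \<in> s" by blast
  then obtain t where t: "t \<in> thin_radical X S" "(y, z) \<in> t" using thin by blast
  have tS: "t \<in> S" using t closed_subset_subset[OF closed_thin_radical] by blast
  have "s O t \<subseteq> s"
  proof (rule subrelI)
    fix x' z' assume "(x', z') \<in> s O t"
    then obtain y' where y': "(x', y') \<in> s" "(y', z') \<in> t" by blast
    have "(x, y) \<in> s O t\<inverse>" using xy t by blast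
    then have "(x', y') \<in> s O t\<inverse>"
      using relcomp_transfer[OF s converse_in[OF tS] s xy(1) y'(1)] by blast
    then obtain w where w: "(x', w) \<in> s" "(y', w) \<in> t" by blast
    then have "w = z'" using thin_single_valued[OF t(1)] y' by blast
    then show "(x', z') \<in> s" using w by simp
  qed
  then show "(y, z) \<in> \<Union>(thin_stabilizer s)" using t unfolding thin_stabilizer_def by blast
next
  fix y z assume "(y, z) \<in> \<Union>(thin_stabilizer s)"
  then obtain t where t: "t \<in> thin_radical X S" "s O t \<subseteq> s" "(y, z) \<in> t"
    unfolding thin_stabilizer_def by blast
  have "t \<in> S" using t closed_subset_subset[OF closed_thin_radical] by blast
  then have "y \<in> X" using in_X(1) t(3) by blast
  then obtain x where "(y, x) \<in> s\<inverse>" using successor[OF converse_in[OF s]] by blast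
  then show "(y, z) \<in> s\<inverse> O s" using t by blast
qed

text \<open>For \<open>s \<in> U - T\<close>, the closed subset of all \<open>u\<close> with \<open>u\<^sup>*u \<subseteq> s\<^sup>*s\<close> contains \<open>T\<close> and \<open>s\<close>, hence \<open>U\<close>.
  So all sets \<open>s\<^sup>*s\<close> with \<open>s \<in> U - T\<close> are equal, and the extension lemma applies.\<close>

lemma homogeneous_of_generation:
  assumes U: "closed_subset S U" and TU: "thin_radical X S \<subseteq> U"
    and thin: "\<And>s. s \<in> U \<Longrightarrow> s\<inverse> O s \<subseteq> \<Union>(thin_radical X S)"
    and gen: "\<And>M s. closed_subset S M \<Longrightarrow> thin_radical X S \<subseteq> M \<Longrightarrow> s \<in> M \<Longrightarrow>
      s \<in> U - thin_radical X S \<Longrightarrow> U \<subseteq> M"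
  shows "homogeneous U"
proof (cases "U = thin_radical X S")
  case True
  then show ?thesis using homogeneous_thin_radical by simp
next
  case False
  let ?T = "thin_radical X S"
  obtain h where h: "h \<in> U" "h \<notin> ?T" using TU False by blast
  have US: "s \<in> S" if "s \<in> U" for s using that closed_subset_subset[OF U] by blast
  have res: "u\<inverse> O u \<subseteq> \<Union>(thin_stabilizer s)" if s: "s \<in> U" "s \<notin> ?T" and u: "u \<in> U" for s u
  proof -
    let ?K = "thin_stabilizer s" let ?M = "{u \<in> S. u\<inverse> O u \<subseteq> \<Union>?K}"
    note K = closed_thin_stabilizer[OF US[OF s(1)]]
    have "t \<in> ?M" if t: "t \<in> ?T" for t
    proof -
      have "Id_on X \<subseteq> \<Union>?K" using closed_Id[OF K] by blast
      then show ?thesis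
        using thin_residue_diagonal[OF t] t closed_subset_subset[OF closed_thin_radical] by blast
    qed
    moreover have "s \<in> ?M"
      using residue_eq_thin_stabilizer[OF US[OF s(1)] thin[OF s(1)]] US[OF s(1)] by blast
    ultimately have "U \<subseteq> ?M" using gen[OF closed_residue[OF K], of s] s by blast
    then show ?thesis using u by blast
  qed
  show ?thesis
  proof (rule homogeneous_extend[OF closed_thin_radical U closed_thin_stabilizer[OF US[OF h(1)]]
        TU homogeneous_thin_radical])
    show "m\<inverse> O m \<subseteq> \<Union>(thin_stabilizer h)" if "m \<in> U" for m using res[OF h that] .
    show "m O \<Union>(thin_stabilizer h) \<subseteq> m" if m: "m \<in> U - ?T" for m
    proof -
      \<comment> \<open>Here \<open>res\<close> is used with \<open>m\<close> as the fixed element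
        and \<open>h\<close> as the varying one: every thin relation stabilizing \<open>h\<close>
        stabilizes \<open>m\<close>.\<close>
      have "\<Union>(thin_stabilizer h) \<subseteq> \<Union>(thin_stabilizer m)"
        using res[of m h] m h residue_eq_thin_stabilizer[OF US[OF h(1)] thin[OF h(1)]] by simp
      then show ?thesis using thin_stabilizer_absorb[of m] by blast
    qed
  qed
qed

section \<open>Strong normality and the thin residue\<close>

text \<open>Commutativity rewrites the product in the definition as
  \<open>(s\<inverse> O s) O \<Union>T\<close>, and a closed \<open>T\<close> contains this exactly
  when it contains the residue of \<open>s\<close>.\<close>

lemma strongly_normal_iff:
  "strongly_normal S T \<longleftrightarrow> closed_subset S T \<and> (\<forall>s\<in>S. s\<inverse> O s \<subseteq> \<Union>T)"
proof -
  have "complex_product S (complex_product S {s\<inverse>} T) {s} \<subseteq> T \<longleftrightarrow> s\<inverse> O s \<subseteq> \<Union>T"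
    if T: "closed_subset S T" and s: "s \<in> S" for s
  proof -
    note TS = closed_subset_subset[OF T]
    have s': "{s\<inverse>} \<subseteq> S" "{s} \<subseteq> S" using s converse_in by blast+
    have "complex_product S (complex_product S {s\<inverse>} T) {s} \<subseteq> T \<longleftrightarrow> (s\<inverse> O \<Union>T) O s \<subseteq> \<Union>T"
      using complex_product_subset_iff[OF complex_product_subset s'(2) TS]
        Union_complex_product[OF s'(1) TS] by simp
    also have "(s\<inverse> O \<Union>T) O s = (s\<inverse> O s) O \<Union>T"
      using relcomp_Union_commute[OF TS s] by (simp add: O_assoc)
    also have "(s\<inverse> O s) O \<Union>T \<subseteq> \<Union>T \<longleftrightarrow> s\<inverse> O s \<subseteq> \<Union>T"
    proof
      assume le: "(s\<inverse> O s) O \<Union>T \<subseteq> \<Union>T"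
      show "s\<inverse> O s \<subseteq> \<Union>T"
      proof (rule subrelI)
        fix x y assume xy: "(x, y) \<in> s\<inverse> O s"
        then have "y \<in> X" using in_X(2)[OF s] by blast
        then have "(y, y) \<in> \<Union>T" by (rule closed_refl[OF T])
        then have "(x, y) \<in> (s\<inverse> O s) O \<Union>T" using xy by (rule relcompI[rotated])
        then show "(x, y) \<in> \<Union>T" using le by blast
      qed
    next
      assume le: "s\<inverse> O s \<subseteq> \<Union>T"
      show "(s\<inverse> O s) O \<Union>T \<subseteq> \<Union>T"
      proof (rule subrelI)
        fix x z assume "(x, z) \<in> (s\<inverse> O s) O \<Union>T"
        then obtain y where "(x, y) \<in> s\<inverse> O s" and yz: "(y, z) \<in> \<Union>T" by (rule relcompE) blast
        then have "(x, y) \<in> \<Union>T" using le by blast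
        then show "(x, z) \<in> \<Union>T" using yz by (rule closed_trans[OF T])
      qed
    qed
    finally show ?thesis .
  qed
  then show ?thesis unfolding strongly_normal_def by blast
qed

lemma thin_residue_mem:
  assumes u: "u \<in> S" "(x, y) \<in> u"
  shows "u \<in> thin_residue S \<longleftrightarrow> (\<forall>T. strongly_normal S T \<longrightarrow> (x, y) \<in> \<Union>T)"
proof -
  have "u \<in> T \<longleftrightarrow> (x, y) \<in> \<Union>T" if "strongly_normal S T" for T
    using in_Union_iff[OF _ u] closed_subset_subset that unfolding strongly_normal_def by metis
  then show ?thesis unfolding thin_residue_def by blast
qed

lemma thin_residue_subset: "strongly_normal S T \<Longrightarrow> thin_residue S \<subseteq> T"
  unfolding thin_residue_def by blast

lemma thin_residue_subset_S: "thin_residue S \<subseteq> S"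
proof (rule thin_residue_subset)
  show "strongly_normal S S"
    unfolding strongly_normal_iff using closed_S closed_residue_subset[OF closed_S] by blast
qed

lemma thin_residue_contains:
  assumes s: "s \<in> S" shows "s\<inverse> O s \<subseteq> \<Union>(thin_residue S)"
proof (rule subrelI)
  fix x y assume xy: "(x, y) \<in> s\<inverse> O s"
  then have "x \<in> X" "y \<in> X" using in_X(2)[OF s] by auto
  then obtain u where u: "u \<in> S" "(x, y) \<in> u" by (rule rel_ex)
  have "u \<in> thin_residue S"
    unfolding thin_residue_mem[OF u] strongly_normal_iff using s xy by blast
  then show "(x, y) \<in> \<Union>(thin_residue S)" using u by blast
qed

lemma closed_thin_residue: "closed_subset S (thin_residue S)"
proof (rule closed_subsetI[OF thin_residue_subset_S])
  show "Id_on X \<in> thin_residue S"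
    unfolding thin_residue_def strongly_normal_iff using closed_Id by blast
  show "\<Union>(thin_residue S) O \<Union>(thin_residue S) \<subseteq> \<Union>(thin_residue S)"
  proof (rule subrelI)
    fix x z assume "(x, z) \<in> \<Union>(thin_residue S) O \<Union>(thin_residue S)"
    then obtain y s t where s: "s \<in> thin_residue S" "(x, y) \<in> s"
      and t: "t \<in> thin_residue S" "(y, z) \<in> t" by blast
    have S: "s \<in> S" "t \<in> S" using s t thin_residue_subset_S by blast+
    have "x \<in> X" "z \<in> X" using in_X(1)[OF S(1) s(2)] in_X(2)[OF S(2) t(2)] .
    then obtain u where u: "u \<in> S" "(x, z) \<in> u" by (rule rel_ex)
    have "(x, z) \<in> \<Union>T" if T: "strongly_normal S T" for T
    proof (rule closed_trans)
      show "closed_subset S T" using T unfolding strongly_normal_def by blast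
      show "(x, y) \<in> \<Union>T" "(y, z) \<in> \<Union>T"
        using s(2) t(2) subsetD[OF thin_residue_subset[OF T]] s(1) t(1) by blast+
    qed
    then have "u \<in> thin_residue S" unfolding thin_residue_mem[OF u] by blast
    then show "(x, z) \<in> \<Union>(thin_residue S)" using u by blast
  qed
qed

section \<open>Thin radical of index \<open>p\<close>; thin radical and thin residue distinct of
  order \<open>p ^ 2\<close>\<close>

text \<open>By Lagrange no closed subset lies strictly between the thin radical and
  \<open>S\<close>, so any element outside the radical generates \<open>S\<close> over it. Index
  \<open>p\<close> also puts every residue into the radical.\<close>

lemma schurian_of_thin_radical_index_p:
  assumes p: "prime p" and card: "card X = p ^ Suc k"
    and val: "\<And>s. s \<in> S \<Longrightarrow> \<exists>j. valency X s = p ^ j"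
    and T: "scheme_order X (thin_radical X S) = p ^ k"
  shows "schurian X S"
proof (intro homogeneous_imp_schurian homogeneous_of_generation closed_S)
  note TS = closed_subset_subset[OF closed_thin_radical]
  show "thin_radical X S \<subseteq> S" by (fact TS)
  show "s\<inverse> O s \<subseteq> \<Union>(thin_radical X S)" if s: "s \<in> S" for s
  proof -
    obtain j where j: "valency X s = p ^ j" using val s by blast
    have idx: "scheme_order X S = p * scheme_order X (thin_radical X S)"
      using card T scheme_order_S by simp
    show ?thesis
      by (rule residue_subset_of_prime_index[OF closed_thin_radical closed_S TS p idx s j])
  qed
  show "S \<subseteq> M" if M: "closed_subset S M" "thin_radical X S \<subseteq> M" "s \<in> M" "s \<in> S - thin_radical X S" for M s
  proof -
    note MS = closed_subset_subset[OF M(1)]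
    have d1: "p ^ k dvd scheme_order X M"
      using scheme_order_dvd[OF closed_thin_radical M(1,2)] T by simp
    have d2: "scheme_order X M dvd p ^ Suc k"
      using scheme_order_dvd[OF M(1) closed_S MS] card scheme_order_S by simp
    have ne: "scheme_order X M \<noteq> p ^ k"
      using eq_of_scheme_order_eq[OF M(2) MS] T M(3,4) by auto
    obtain j where j: "j \<le> Suc k" "scheme_order X M = p ^ j"
      using d2 p by (meson divides_primepow_nat)
    have "k \<le> j" using d1 j(2) p by (metis power_dvd_imp_le prime_gt_1_nat)
    then have "j = Suc k" using j ne by (cases "j = k") auto
    then have "M = S" using eq_of_scheme_order_eq[OF MS subset_refl] j(2) card scheme_order_S by simp
    then show ?thesis by simp
  qed
qed

text \<open>The class equation argument known from p-groups: every non-thin element contributes a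
  multiple of \<open>p\<close>.\<close>

lemma scheme_order_Int_thin_radical_mod:
  assumes p: "prime p" and val: "\<And>s. s \<in> S \<Longrightarrow> \<exists>j. valency X s = p ^ j"
    and R: "R \<subseteq> S" and dvd: "p dvd scheme_order X R"
  shows "p dvd scheme_order X (thin_radical X S \<inter> R)"
proof -
  let ?T = "thin_radical X S"
  have "finite R" using R finite_S finite_subset by blast
  then have "scheme_order X R = scheme_order X (?T \<inter> R) + (\<Sum>s\<in>R - ?T. valency X s)"
    unfolding scheme_order_def using sum.Int_Diff[of R _ ?T] by (simp add: Int_commute)
  moreover have "p dvd (\<Sum>s\<in>R - ?T. valency X s)"
  proof (rule dvd_sum)
    fix s assume s: "s \<in> R - ?T"
    then have "s \<in> S" using R by blast
    then obtain j where j: "valency X s = p ^ j" using val by blast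
    then have "j \<noteq> 0" using s \<open>s \<in> S\<close> unfolding thin_radical_def by (intro notI) simp
    then show "p dvd valency X s" using j by simp
  qed
  ultimately show ?thesis using dvd by (simp add: dvd_add_left_iff)
qed

text \<open>The intersection \<open>K\<close> has order \<open>p\<close>, hence index
  \<open>p\<close> in the thin residue. This confines the residues of elements of \<open>H\<close>
  to \<open>K\<close>. Valencies then give absorption: of \<open>K\<close> by elements of
  \<open>H\<close> that are not thin, and of the thin residue by elements outside
  \<open>H\<close>.\<close>

lemma schurian_of_wedge:
  assumes p: "prime p" and val: "\<And>s. s \<in> S \<Longrightarrow> \<exists>j. valency X s = p ^ j"
    and T: "scheme_order X (thin_radical X S) = p ^ 2"
    and R: "scheme_order X (thin_residue S) = p ^ 2"
    and neq: "thin_residue S \<noteq> thin_radical X S"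
    and out: "\<And>s. s \<in> S - complex_product S (thin_radical X S) (thin_residue S) \<Longrightarrow> valency X s = p ^ 2"
  shows "schurian X S"
proof -
  let ?T = "thin_radical X S" and ?R = "thin_residue S"
  define K where "K = ?T \<inter> ?R"
  define H where "H = complex_product S ?T ?R"
  note cT = closed_thin_radical and cR = closed_thin_residue
  have cK: "closed_subset S K" unfolding K_def using closed_Int[OF cT cR] .
  have cH: "closed_subset S H" and TH: "?T \<subseteq> H" and RH: "?R \<subseteq> H"
    unfolding H_def using closed_complex_product[OF cT cR] by simp_all
  have KR: "K \<subseteq> ?R" unfolding K_def by blast
  \<comment> \<open>The order of \<open>K\<close> is a multiple of \<open>p\<close> dividing
    \<open>p ^ 2\<close>; the value \<open>p ^ 2\<close> would make residue and radical
    equal.\<close>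
  have "p dvd scheme_order X K" unfolding K_def
    using scheme_order_Int_thin_radical_mod[OF p val thin_residue_subset_S] R by simp
  moreover have "scheme_order X K dvd p ^ 2" using scheme_order_dvd[OF cK cR KR] R by simp
  then obtain j where j: "j \<le> 2" "scheme_order X K = p ^ j" using p by (meson divides_primepow_nat)
  moreover have "scheme_order X K \<noteq> p ^ 2"
  proof
    assume "scheme_order X K = p ^ 2"
    then have "K = ?R" using eq_of_scheme_order_eq[OF KR thin_residue_subset_S] R by simp
    then have "?R \<subseteq> ?T" unfolding K_def by blast
    then show False
      using eq_of_scheme_order_eq[OF _ closed_subset_subset[OF cT]] R T neq by simp
  qed
  moreover have "p \<noteq> 1" using p by auto
  ultimately have oK: "scheme_order X K = p"
    by (cases "j = 0"; cases "j = 1"; cases "j = 2") auto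
  have big: "scheme_order X K \<le> valency X s" if s: "s \<in> S" "s \<notin> ?T" for s
  proof -
    obtain i where i: "valency X s = p ^ i" using val s by blast
    then have "i \<noteq> 0" using s unfolding thin_radical_def by (intro notI) simp
    then show ?thesis using i oK p self_le_power[of p i] prime_ge_1_nat by simp
  qed
  have resR: "s\<inverse> O s \<subseteq> \<Union>K" if s: "s \<in> ?R" for s
  proof -
    obtain i where i: "valency X s = p ^ i" using val s thin_residue_subset_S by blast
    have idx: "scheme_order X ?R = p * scheme_order X K" using R oK by (simp add: power2_eq_square)
    show ?thesis by (rule residue_subset_of_prime_index[OF cK cR KR p idx s i])
  qed
  have resH: "s\<inverse> O s \<subseteq> \<Union>K" if s: "s \<in> H" for s
  proof -
    \<comment> \<open>The elements with residue in \<open>K\<close> form a closed subset containing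
      both factors of \<open>H\<close>.\<close>
    let ?M = "{s \<in> S. s\<inverse> O s \<subseteq> \<Union>K}"
    have "Id_on X \<subseteq> \<Union>K" using closed_Id[OF cK] by blast
    then have "?T \<subseteq> ?M" using thin_residue_diagonal closed_subset_subset[OF cT] by blast
    moreover have "?R \<subseteq> ?M" using resR thin_residue_subset_S by blast
    ultimately have "H \<subseteq> ?M" unfolding H_def using complex_product_least[OF closed_residue[OF cK]] by blast
    then show ?thesis using s by blast
  qed
  note HS = closed_subset_subset[OF cH]
  have hH: "homogeneous H"
  proof (rule homogeneous_extend[OF cT cH cK TH homogeneous_thin_radical resH])
    show "m O \<Union>K \<subseteq> m" if m: "m \<in> H - ?T" for m
      using absorb_of_valency_ge[OF cK _ resH[of m] big[of m]] m HS by blast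
  qed
  have "homogeneous S"
  proof (rule homogeneous_extend[OF cH closed_S cR HS hH thin_residue_contains])
    show "m O \<Union>?R \<subseteq> m" if m: "m \<in> S - H" for m
    proof -
      have "valency X m = p ^ 2" using out m unfolding H_def by blast
      then show ?thesis using absorb_of_valency_ge[OF cR _ thin_residue_contains] m R by simp
    qed
  qed
  then show ?thesis by (rule homogeneous_imp_schurian)
qed

section \<open>Quotient schemes and the case of a cyclic quotient\<close>

text \<open>The outer factors \<open>T\<close> in the definition only replace end points by others
  in their cosets, so the pairs of \<open>s\<close> already yield all pairs of cosets.\<close>

lemma quotient_relation_eq:
  assumes T: "closed_subset S T" and s: "s \<in> S"
  shows "quotient_relation X S T s = {(\<Union>T `` {x}, \<Union>T `` {y}) | x y. (x, y) \<in> s}"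
proof -
  note TS = closed_subset_subset[OF T]
  have coset: "scheme_coset x U = \<Union>U `` {x}" for x :: 'a and U
    unfolding scheme_coset_def by blast
  have "\<Union>(complex_product S (complex_product S T {s}) T) = (\<Union>T O s) O \<Union>T"
    using Union_complex_product[OF complex_product_subset TS] Union_complex_product[OF TS, of "{s}"] s
    by simp
  then have q: "quotient_relation X S T s =
      {(\<Union>T `` {x}, \<Union>T `` {y}) | x y. x \<in> X \<and> (x, y) \<in> (\<Union>T O s) O \<Union>T}"
    unfolding quotient_relation_def coset by auto
  show ?thesis
  proof (intro equalityI subsetI)
    fix P assume "P \<in> quotient_relation X S T s"
    then obtain x y where P: "P = (\<Union>T `` {x}, \<Union>T `` {y})" and xy: "(x, y) \<in> (\<Union>T O s) O \<Union>T"
      unfolding q by blast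
    obtain a b where ab: "(x, a) \<in> \<Union>T" "(a, b) \<in> s" "(b, y) \<in> \<Union>T"
      using xy by (elim relcompE) blast
    then have "P = (\<Union>T `` {a}, \<Union>T `` {b})"
      using P closed_class_eq[OF T ab(1)] closed_class_eq[OF T ab(3)] by simp
    then show "P \<in> {(\<Union>T `` {x}, \<Union>T `` {y}) | x y. (x, y) \<in> s}" using ab by blast
  next
    fix P assume "P \<in> {(\<Union>T `` {x}, \<Union>T `` {y}) | x y. (x, y) \<in> s}"
    then obtain x y where P: "P = (\<Union>T `` {x}, \<Union>T `` {y})" and xy: "(x, y) \<in> s" by blast
    have X: "x \<in> X" "y \<in> X" using in_X[OF s xy] .
    have "(x, y) \<in> (\<Union>T O s) O \<Union>T"
      using closed_refl[OF T X(1)] xy closed_refl[OF T X(2)] by (intro relcompI)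
    then show "P \<in> quotient_relation X S T s" unfolding q using P X by blast
  qed
qed

text \<open>Modulo \<open>T\<close> every relation is single valued, so the composition of two
  images is the image of any one relation inside the product: passing to the quotient acts like a
  homomorphism.\<close>

lemma quotient_relation_relcomp:
  assumes T: "closed_subset S T" and thin: "\<And>s. s \<in> S \<Longrightarrow> s\<inverse> O s \<subseteq> \<Union>T"
    and s: "s \<in> S" and t: "t \<in> S" and u: "u \<in> S" and xy: "(x, y) \<in> u" "(x, y) \<in> s O t"
  shows "quotient_relation X S T u = quotient_relation X S T s O quotient_relation X S T t"
  unfolding quotient_relation_eq[OF T s] quotient_relation_eq[OF T t] quotient_relation_eq[OF T u]
proof (intro equalityI subsetI)
  fix P assume "P \<in> {(\<Union>T `` {x}, \<Union>T `` {y}) | x y. (x, y) \<in> u}"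
  then obtain a b where P: "P = (\<Union>T `` {a}, \<Union>T `` {b})" and "(a, b) \<in> u" by blast
  then have "(a, b) \<in> s O t" using relcomp_transfer[OF s t u xy(1) _ xy(2)] by blast
  then show "P \<in> {(\<Union>T `` {x}, \<Union>T `` {y}) | x y. (x, y) \<in> s} O
      {(\<Union>T `` {x}, \<Union>T `` {y}) | x y. (x, y) \<in> t}" using P by blast
next
  fix P assume "P \<in> {(\<Union>T `` {x}, \<Union>T `` {y}) | x y. (x, y) \<in> s} O
      {(\<Union>T `` {x}, \<Union>T `` {y}) | x y. (x, y) \<in> t}"
  then obtain a b c d where P: "P = (\<Union>T `` {a}, \<Union>T `` {d})" and ab: "(a, b) \<in> s"
    and cd: "(c, d) \<in> t" and bc: "\<Union>T `` {b} = \<Union>T `` {c}" by blast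
  have "(c, c) \<in> \<Union>T" using closed_refl[OF T in_X(1)[OF t cd]] .
  then have "(b, c) \<in> \<Union>T" using bc by blast
  then have "(a, c) \<in> s O \<Union>T" using ab by blast
  \<comment> \<open>Moving the step inside a \<open>T\<close>-coset to the front turns the broken
    path into a genuine path along \<open>s\<close> and \<open>t\<close>, starting at another point
    of the coset of \<open>a\<close>.\<close>
  then have "(a, c) \<in> \<Union>T O s" using relcomp_Union_commute[OF closed_subset_subset[OF T] s] by simp
  then obtain a' where a': "(a, a') \<in> \<Union>T" "(a', c) \<in> s" by blast
  have ad: "(a', d) \<in> s O t" using a' cd by blast
  obtain e where e: "(a', e) \<in> u" using successor[OF u in_X(1)[OF s a'(2)]] by blast
  have "(a', e) \<in> s O t" using relcomp_transfer[OF s t u xy(1) e xy(2)] .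
  then have "(d, e) \<in> \<Union>T" using relcomp_single_class[OF T s t thin[OF s] thin[OF t] ad] by blast
  then have "P = (\<Union>T `` {a'}, \<Union>T `` {e})"
    using P closed_class_eq[OF T a'(1)] closed_class_eq[OF T, of d e] by simp
  then show "P \<in> {(\<Union>T `` {x}, \<Union>T `` {y}) | x y. (x, y) \<in> u}" using e by blast
qed

text \<open>A closed subset containing \<open>T\<close> is a union of fibres of the quotient map,
  since moving end points within \<open>T\<close>-cosets does not leave it.\<close>

lemma mem_of_quotient_relation_eq:
  assumes T: "closed_subset S T" and M: "closed_subset S M" and TM: "T \<subseteq> M"
    and s: "s \<in> S" and t: "t \<in> M" and eq: "quotient_relation X S T s = quotient_relation X S T t"
  shows "s \<in> M"
proof -
  note MS = closed_subset_subset[OF M]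
  obtain x y where xy: "(x, y) \<in> s" using s by (rule rel_nonempty)
  have "(\<Union>T `` {x}, \<Union>T `` {y}) \<in> quotient_relation X S T t"
    using xy unfolding eq[symmetric] quotient_relation_eq[OF T s] by blast
  then obtain a b where ab: "(a, b) \<in> t" "\<Union>T `` {x} = \<Union>T `` {a}" "\<Union>T `` {y} = \<Union>T `` {b}"
    unfolding quotient_relation_eq[OF T subsetD[OF MS t]] by blast
  have X: "a \<in> X" "y \<in> X" using in_X(1)[OF subsetD[OF MS t] ab(1)] in_X(2)[OF s xy] .
  have "(x, a) \<in> \<Union>T" using closed_refl[OF T X(1)] ab(2) by blast
  moreover have "(b, y) \<in> \<Union>T" using closed_refl[OF T X(2)] ab(3) by blast
  ultimately have "(x, a) \<in> \<Union>M" "(a, b) \<in> \<Union>M" "(b, y) \<in> \<Union>M" using TM ab t by blast+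
  then have "(x, y) \<in> \<Union>M" using closed_trans[OF M] by metis
  then show ?thesis using in_Union_iff[OF MS s xy] by simp
qed

lemma quotient_relation_mem:
  assumes T: "closed_subset S T" and t: "t \<in> T"
  shows "quotient_relation X S T t = quotient_relation X S T (Id_on X)"
proof -
  have tS: "t \<in> S" using t closed_subset_subset[OF T] by blast
  have eq: "\<Union>T `` {a} = \<Union>T `` {b}" if "(a, b) \<in> t" for a b
    using closed_class_eq[OF T, of a b] t that by blast
  show ?thesis
    unfolding quotient_relation_eq[OF T tS] quotient_relation_eq[OF T Id_in]
  proof (intro equalityI subsetI)
    fix P assume "P \<in> {(\<Union>T `` {x}, \<Union>T `` {y}) | x y. (x, y) \<in> t}"
    then obtain a b where ab: "P = (\<Union>T `` {a}, \<Union>T `` {b})" "(a, b) \<in> t" by blast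
    then show "P \<in> {(\<Union>T `` {x}, \<Union>T `` {y}) | x y. (x, y) \<in> Id_on X}"
      using eq[OF ab(2)] in_X(1)[OF tS ab(2)] by blast
  next
    fix P assume "P \<in> {(\<Union>T `` {x}, \<Union>T `` {y}) | x y. (x, y) \<in> Id_on X}"
    then obtain a where a: "P = (\<Union>T `` {a}, \<Union>T `` {a})" "a \<in> X" by blast
    obtain b where b: "(a, b) \<in> t" using successor[OF tS a(2)] by blast
    then have "P = (\<Union>T `` {a}, \<Union>T `` {b})" using a(1) eq[OF b] by simp
    then show "P \<in> {(\<Union>T `` {x}, \<Union>T `` {y}) | x y. (x, y) \<in> t}" using b by blast
  qed
qed

text \<open>The isomorphism labels the elements of \<open>S\<close> by integers modulo
  \<open>p ^ 2\<close>. Over \<open>T\<close>, an element generates everything whose label is a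
  multiple of the gcd of its own label and \<open>p ^ 2\<close>; thus elements of
  \<open>U - T\<close> generate \<open>U\<close>, and elements outside \<open>U\<close> generate
  \<open>S\<close>.\<close>

lemma schurian_of_cyclic_quotient:
  assumes p: "prime p" and RT: "thin_residue S = thin_radical X S"
    and iso: "scheme_monoid (quotient_points X (thin_radical X S))
      (quotient_scheme X S (thin_radical X S)) \<cong> integer_mod_group (p ^ 2)"
  shows "schurian X S"
proof -
  define T where "T = thin_radical X S"
  define q where "q = quotient_relation X S T"
  define n where "n = int (p ^ 2)"
  have cT: "closed_subset S T" unfolding T_def by (rule closed_thin_radical)
  have thin: "s\<inverse> O s \<subseteq> \<Union>T" if "s \<in> S" for s
    using thin_residue_contains[OF that] RT unfolding T_def by simp
  have n0: "n > 0" and nat_n: "p ^ 2 \<noteq> 0" using p prime_gt_0_nat unfolding n_def by auto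
  let ?Q = "scheme_monoid (quotient_points X T) (quotient_scheme X S T)"
  obtain \<phi> where \<phi>: "\<phi> \<in> Group.iso ?Q (integer_mod_group (p ^ 2))"
    using iso unfolding is_iso_def T_def by blast
  have carr: "carrier ?Q = q ` S"
    unfolding scheme_monoid_def quotient_scheme_def q_def by auto
  have hom: "\<phi> (a O b) = (\<phi> a + \<phi> b) mod n" if "a \<in> q ` S" "b \<in> q ` S" for a b
    using \<phi> that carr unfolding Group.iso_def hom_def n_def by (auto simp: scheme_monoid_def)
  have bij: "bij_betw \<phi> (q ` S) {0..<n}"
    using \<phi> carr nat_n unfolding Group.iso_def n_def by (simp add: carrier_integer_mod_group)
  define \<pi> where "\<pi> s = \<phi> (q s)" for s
  have range: "\<pi> s \<in> {0..<n}" if "s \<in> S" for s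
    unfolding \<pi>_def using bij_betwE[OF bij] that by blast
  have add: "\<pi> u = (\<pi> s + \<pi> t) mod n"
    if "s \<in> S" "t \<in> S" "u \<in> S" "(x, y) \<in> u" "(x, y) \<in> s O t" for s t u x y
    using hom[of "q s" "q t"] quotient_relation_relcomp[OF cT thin that] that(1,2)
    unfolding \<pi>_def q_def by simp
  \<comment> \<open>The label of the diagonal is idempotent under addition modulo
    \<open>n\<close>.\<close>
  have zero: "\<pi> (Id_on X) = 0"
  proof -
    obtain x where "x \<in> X" using X_nonempty by blast
    then have "\<pi> (Id_on X) = (\<pi> (Id_on X) + \<pi> (Id_on X)) mod n"
      using add[OF Id_in Id_in Id_in, of x x] by blast
    then have "n dvd \<pi> (Id_on X) + \<pi> (Id_on X) - \<pi> (Id_on X)"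
      using mod_eq_dvd_iff range[OF Id_in] by (metis mod_mod_trivial)
    then show ?thesis using range[OF Id_in] by (auto dest: zdvd_imp_le)
  qed
  have mem: "s \<in> M" if M: "closed_subset S M" "T \<subseteq> M" and "s \<in> S" "t \<in> M" "\<pi> s = \<pi> t" for s t M
  proof -
    have "t \<in> S" using that closed_subset_subset[OF M(1)] by blast
    then have "q s = q t" using bij that unfolding \<pi>_def bij_betw_def inj_on_def by blast
    then show ?thesis using mem_of_quotient_relation_eq[OF cT M(1,2) that(3,4)] unfolding q_def by simp
  qed
  have nonzero: "\<pi> s \<noteq> 0" if "s \<in> S" "s \<notin> T" for s
    using mem[OF cT subset_refl that(1) closed_Id[OF cT]] zero that(2) by metis
  \<comment> \<open>Each induction step extends a path inside \<open>M\<close> by one more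
    \<open>s\<close>, which adds the label of \<open>s\<close>.\<close>
  have multiples: "\<exists>u\<in>M. \<pi> u = (int k * \<pi> s) mod n" if M: "closed_subset S M" "s \<in> M" for M s k
  proof (induction k)
    case 0
    show ?case using closed_Id[OF M(1)] zero by auto
  next
    case (Suc k)
    note MS = closed_subset_subset[OF M(1)]
    obtain u where u: "u \<in> M" "\<pi> u = (int k * \<pi> s) mod n" using Suc by blast
    obtain x y where xy: "(x, y) \<in> u" using u MS rel_nonempty by blast
    have "y \<in> X" using in_X(2) u xy MS by blast
    then obtain z where z: "(y, z) \<in> s" using successor M MS by blast
    have "(x, z) \<in> \<Union>M" using closed_trans[OF M(1), of x y z] xy z u M by blast
    then obtain v where v: "v \<in> M" "(x, z) \<in> v" by blast
    have "\<pi> v = (\<pi> u + \<pi> s) mod n"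
      using add[OF subsetD[OF MS u(1)] subsetD[OF MS M(2)] subsetD[OF MS v(1)] v(2)] xy z by blast
    also have "\<dots> = (int (Suc k) * \<pi> s) mod n"
      unfolding u(2) by (simp add: mod_add_left_eq mod_add_right_eq algebra_simps)
    finally show ?case using v by blast
  qed
  have reach: "v \<in> M" if M: "closed_subset S M" "T \<subseteq> M" "s \<in> M" and v: "v \<in> S"
    and g: "gcd (\<pi> s) n dvd \<pi> v" for M s v
  proof -
    obtain c where c: "\<pi> v = gcd (\<pi> s) n * c" using g by blast
    obtain a b where ab: "a * \<pi> s + b * n = gcd (\<pi> s) n" using bezout_int by blast
    \<comment> \<open>By Bezout the label of \<open>v\<close> is \<open>a * c\<close> times that of
      \<open>s\<close> modulo \<open>n\<close>; reduction modulo \<open>n\<close> makes the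
      coefficient a natural number, as \<open>multiples\<close> requires.\<close>
    define k where "k = nat ((a * c) mod n)"
    obtain u where u: "u \<in> M" "\<pi> u = (int k * \<pi> s) mod n" using multiples[OF M(1,3)] by blast
    have "int k * \<pi> s mod n = (a * c) * \<pi> s mod n"
      unfolding k_def using n0 by (simp add: mod_mult_left_eq)
    also have "(a * c) * \<pi> s = \<pi> v + n * (- b * c)"
      unfolding c ab[symmetric] by (simp add: algebra_simps)
    also have "(\<pi> v + n * (- b * c)) mod n = \<pi> v" using range[OF v] unfolding mod_mult_self2 by simp
    finally show ?thesis using mem[OF M(1,2) v u(1)] u(2) by simp
  qed
  have gcd_cases: "gcd (\<pi> s) n = 1 \<or> gcd (\<pi> s) n = int p" if s: "s \<in> S" "s \<notin> T" for s
  proof -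
    have "nat (gcd (\<pi> s) n) dvd p ^ 2" unfolding n_def
      by (metis gcd_dvd2 gcd_ge_0_int int_nat_eq of_nat_dvd_iff)
    then obtain i where i: "i \<le> 2" "nat (gcd (\<pi> s) n) = p ^ i"
      using p by (meson divides_primepow_nat)
    have g: "gcd (\<pi> s) n = int (p ^ i)" using i(2) by (metis gcd_ge_0_int int_nat_eq)
    \<comment> \<open>A gcd equal to \<open>n\<close> would force the label zero, which occurs only
      in \<open>T\<close>.\<close>
    have "i \<noteq> 2"
    proof
      assume "i = 2"
      then have "n dvd \<pi> s" using g unfolding n_def by (metis gcd_dvd1)
      then show False using nonzero[OF s] range[OF s(1)] by (auto dest: zdvd_imp_le)
    qed
    then have "i = 0 \<or> i = 1" using i(1) by auto
    then show ?thesis using g by auto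
  qed
  define U where "U = {s \<in> S. int p dvd \<pi> s}"
  have pn: "int p dvd n" unfolding n_def by (simp add: power2_eq_square)
  have cU: "closed_subset S U"
  proof (rule closed_subsetI)
    show "U \<subseteq> S" unfolding U_def by blast
    show "Id_on X \<in> U" unfolding U_def using Id_in zero by simp
    show "\<Union>U O \<Union>U \<subseteq> \<Union>U"
    proof (rule subrelI)
      fix x z assume "(x, z) \<in> \<Union>U O \<Union>U"
      then obtain s t where s: "s \<in> S" "int p dvd \<pi> s" and t: "t \<in> S" "int p dvd \<pi> t"
        and xz: "(x, z) \<in> s O t" unfolding U_def by blast
      have "x \<in> X" "z \<in> X" using xz in_X(1)[OF s(1)] in_X(2)[OF t(1)] by auto
      then obtain u where u: "u \<in> S" "(x, z) \<in> u" by (rule rel_ex)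
      have "int p dvd \<pi> u"
        unfolding add[OF s(1) t(1) u xz] using s t pn by (simp add: dvd_mod_iff)
      then show "(x, z) \<in> \<Union>U" using u unfolding U_def by blast
    qed
  qed
  have TU: "T \<subseteq> U"
  proof
    fix t assume t: "t \<in> T"
    then have tS: "t \<in> S" using closed_subset_subset[OF cT] by blast
    have "\<pi> t = \<pi> (Id_on X)" unfolding \<pi>_def q_def quotient_relation_mem[OF cT t] ..
    then show "t \<in> U" using zero tS unfolding U_def by simp
  qed
  note US = closed_subset_subset[OF cU]
  have hU: "homogeneous U"
  proof (rule homogeneous_of_generation[OF cU, folded T_def, OF TU])
    show "s\<inverse> O s \<subseteq> \<Union>T" if "s \<in> U" for s using thin that US by blast
    show "U \<subseteq> M" if M: "closed_subset S M" "T \<subseteq> M" "s \<in> M" "s \<in> U - T" for M s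
    proof
      fix v assume v: "v \<in> U"
      \<comment> \<open>The gcd is \<open>1\<close> or \<open>p\<close>, and either divides every
        label in \<open>U\<close>.\<close>
      have "gcd (\<pi> s) n dvd \<pi> v"
        using gcd_cases[of s] M(4) v unfolding U_def by auto
      then show "v \<in> M" using reach[OF M(1-3)] v US by blast
    qed
  qed
  have "homogeneous S"
  proof (rule homogeneous_extend[OF cU closed_S cT US hU thin])
    show "m O \<Union>T \<subseteq> m" if m: "m \<in> S - U" for m
    proof -
      let ?K = "thin_stabilizer m" and ?M = "{u \<in> S. u\<inverse> O u \<subseteq> \<Union>(thin_stabilizer m)}"
      have mS: "m \<in> S" using m by blast
      note K = closed_thin_stabilizer[OF mS]
      have "Id_on X \<subseteq> \<Union>?K" using closed_Id[OF K] by blast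
      then have TM: "T \<subseteq> ?M"
        using thin_residue_diagonal closed_subset_subset[OF cT] unfolding T_def by blast
      have mM: "m \<in> ?M"
        using residue_eq_thin_stabilizer[OF mS] thin[OF mS] mS unfolding T_def by simp
      have "gcd (\<pi> m) n \<noteq> int p" using m unfolding U_def by (metis DiffD1 DiffD2 gcd_dvd1 mem_Collect_eq)
      then have "gcd (\<pi> m) n = 1" using gcd_cases[OF mS] m TU by blast
      then have "S \<subseteq> ?M" using reach[OF closed_residue[OF K] TM mM] by auto
      \<comment> \<open>Since \<open>m\<close> generates \<open>S\<close> over \<open>T\<close>, all
        residues lie in the stabilizer of \<open>m\<close>. Minimality of the thin residue, which
        equals \<open>T\<close>, then shows that all of \<open>T\<close> stabilizes
        \<open>m\<close>.\<close>
      then have "strongly_normal S ?K" unfolding strongly_normal_iff using K by blast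
      then have "T \<subseteq> ?K" using thin_residue_subset RT unfolding T_def by simp
      then show ?thesis using thin_stabilizer_absorb[of m] by blast
    qed
  qed
  then show ?thesis by (rule homogeneous_imp_schurian)
qed

end

theorem theorem1p1:
  fixes p :: nat and X :: "'a set" and S :: "'a rel set"
  assumes "prime p" and "odd p"
    and "p_scheme p X S"
    and "commutative_scheme S"
    and "scheme_order X S = p ^ 4"
    and "(thin_residue S = thin_radical X S \<and>
          scheme_order X (thin_radical X S) = p ^ 2 \<and>
          scheme_monoid (quotient_points X (thin_residue S)) (quotient_scheme X S (thin_residue S))
            \<cong> integer_mod_group (p ^ 2))
       \<or> (scheme_order X (thin_radical X S) = p ^ 2 \<and>
          scheme_order X (thin_residue S) = p ^ 2 \<and>
          thin_residue S \<noteq> thin_radical X S \<and>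
          (\<forall>s \<in> S - complex_product S (thin_radical X S) (thin_residue S). valency X s = p ^ 2))
       \<or> scheme_order X (thin_radical X S) = p ^ 3"
  shows "schurian X S"
proof -
  interpret comm_scheme X S
    using assms(3,4) unfolding p_scheme_def by unfold_locales auto
  have val: "\<And>s. s \<in> S \<Longrightarrow> \<exists>j. valency X s = p ^ j" using assms(3) unfolding p_scheme_def by blast
  have card: "card X = p ^ Suc 3" using assms(5) scheme_order_S by simp
  \<comment> \<open>In the first alternative the thin residue in the quotient is replaced by the
    thin radical, to which it is equal.\<close>
  from assms(6) consider
      "thin_residue S = thin_radical X S"
      "scheme_monoid (quotient_points X (thin_radical X S)) (quotient_scheme X S (thin_radical X S))
        \<cong> integer_mod_group (p ^ 2)"
    | "scheme_order X (thin_radical X S) = p ^ 2" "scheme_order X (thin_residue S) = p ^ 2"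
      "thin_residue S \<noteq> thin_radical X S"
      "\<And>s. s \<in> S - complex_product S (thin_radical X S) (thin_residue S) \<Longrightarrow> valency X s = p ^ 2"
    | "scheme_order X (thin_radical X S) = p ^ 3"
    by auto
  then show ?thesis
  proof cases
    case 1
    then show ?thesis by (rule schurian_of_cyclic_quotient[OF assms(1)])
  next
    case 2
    show ?thesis using schurian_of_wedge[OF assms(1) val 2] .
  next
    case 3
    show ?thesis using schurian_of_thin_radical_index_p[OF assms(1) card val 3] .
  qed
qed

end
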